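(* Let $(\Phi_i,\Psi_i)$, $i=1,2$, be complementary Young pairs which satisfy the local $\Delta_2$-condition, are strictly convex and continuous. Let $\sigma\in L^{\Phi_1,\Phi_2}(\mathbb{Z}^n\times\mathbb{T}^n)$ and $g_1,g_2\in\mathcal{S}(\mathbb{Z}^n)$. Suppose also that there exists a constant $x_0>0$ such that $\Psi_i(x)\lesssim\Phi_i(x)$ for all $0\le x\le x_0$, $i=1,2$. Then the localization operator $\mathfrak{L}^{g_1,g_2}_\sigma$ is in $\mathcal{B}(M^{\Phi_1,\Phi_2}(\mathbb{Z}^n))$, and $$\|\mathfrak{L}^{g_1,g_2}_\sigma\|_{\mathcal{B}(M^{\Phi_1,\Phi_2}(\mathbb{Z}^n))}\le\|\sigma\|_{L^{\Phi_1,\Phi_2}(\mathbb{Z}^n\times\mathbb{T}^n)}.$$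
   Context: A Young function is a convex function $\Phi:[0,\infty]\to[0,\infty]$ with $\Phi(0)=0$ and $\lim_{t\to\infty}\Phi(t)=\Phi(\infty)=\infty$. Its complementary function is $\Psi(y)=\sup\{x|y|-\Phi(x):x\ge 0\}$, and $(\Phi,\Psi)$ is then called a complementary Young pair. A Young function $\Phi$ satisfies the local $\Delta_2$-condition if there are $r>0$, $C>0$ with $\Phi(2x)\le C\Phi(x)$ for $x\in[0,r]$. $\Psi_i(x)\lesssim\Phi_i(x)$ means $\Psi_i(x)\le C\Phi_i(x)$ for a constant $C>0$ independent of $x$ in the stated range. For a measure space $X$ (here $\mathbb{Z}^n$ with counting measure, or $\mathbb{T}^n$ with normalized Haar measure) the Orlicz space $L^\Phi(X)$ (written $\ell^\Phi$ when $X=\mathbb{Z}^n$) has norm $\|f\|_{L^\Phi(X)}=\inf\{b>0:\int_X\Phi(|f|/b)\,d\mu\le 1\}$. The mixed Orlicz space $L^{\Phi_1,\Phi_2}(\mathbb{Z}^n\times\mathbb{T}^n)$ consists of the measurable $F$ with $\|F\|_{L^{\Phi_1,\Phi_2}(\mathbb{Z}^n\times\mathbb{T}^n)}=\|F_1\|_{L^{\Phi_2}(\mathbb{T}^n)}<\infty$, where $F_1(w)=\|F(\cdot,w)\|_{\ell^{\Phi_1}(\mathbb{Z}^n)}$. $\mathcal{S}(\mathbb{Z}^n)$ is the space of rapidly decreasing functions on $\mathbb{Z}^n$ ($|g(k)|\le C_{g,M}(1+|k|)^{-M}$ for every $M$) with seminorms $\sup_k(1+|k|)^j|g(k)|$,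 $j\in\mathbb{N}_0$; $\mathcal{S}'(\mathbb{Z}^n)$ is its topological dual. Translation and modulation are $T_kf(m)=f(m-k)$, $M_wf(m)=e^{2\pi i w\cdot m}f(m)$. The short-time Fourier transform is $V_gf(m,w)=\langle f,M_wT_mg\rangle=\sum_{k\in\mathbb{Z}^n}f(k)\overline{g(k-m)}e^{-2\pi i w\cdot k}$, $(m,w)\in\mathbb{Z}^n\times\mathbb{T}^n$. With a fixed non-zero window $g_0\in\mathcal{S}(\mathbb{Z}^n)$, $M^{\Phi_1,\Phi_2}(\mathbb{Z}^n)$ is the space of $f\in\mathcal{S}'(\mathbb{Z}^n)$ with $\|f\|_{M^{\Phi_1,\Phi_2}(\mathbb{Z}^n)}=\|V_{g_0}f\|_{L^{\Phi_1,\Phi_2}(\mathbb{Z}^n\times\mathbb{T}^n)}<\infty$, and similarly $M^{\Psi_1,\Psi_2}(\mathbb{Z}^n)$; the spaces are independent of the choice of window. $M^{\Psi_1,\Psi_2}(\mathbb{Z}^n)$ is identified with the dual of $M^{\Phi_1,\Phi_2}(\mathbb{Z}^n)$ via $\langle f,h\rangle=\sum_m\int_{\mathbb{T}^n}V_{g_0}f(m,w)\overline{V_{g_0}h(m,w)}\,dw$. The localization operator with symbol $\sigma$ and windows $g_1,g_2$ is $\mathfrak{L}^{g_1,g_2}_\sigma f(k)=\sum_{m\in\mathbb{Z}^n}\int_{\mathbb{T}^n}\sigma(m,w)V_{g_1}f(m,w)\,M_wT_mg_2(k)\,dw$, understood in the weak sense: $\langle\mathfrak{L}^{g_1,g_2}_\sigma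 f,h\rangle=\sum_{m\in\mathbb{Z}^n}\int_{\mathbb{T}^n}\sigma(m,w)V_{g_1}f(m,w)\overline{V_{g_2}h(m,w)}\,dw$ for $f\in M^{\Phi_1,\Phi_2}(\mathbb{Z}^n)$, $h\in M^{\Psi_1,\Psi_2}(\mathbb{Z}^n)$. $\mathcal{B}(M^{\Phi_1,\Phi_2}(\mathbb{Z}^n))$ denotes the bounded linear operators on $M^{\Phi_1,\Phi_2}(\mathbb{Z}^n)$ with the operator norm.
   Formalization: The norm bound is proved as ≤ C‖σ‖ with C>0 independent of σ (depending on the Young functions, n and the windows g_0,g_1,g_2); constant 1 is false: for Φ_i=Ψ_i=x²/2, n=1, all windows δ_0, σ=1_{m=0}, the operator norm is 1 but ‖σ‖=1/2. *)

theory Defs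
  imports "HOL-Analysis.Analysis"
begin

section \<open>Young functions\<close>

text \<open>
  Young functions live on \<open>[0,\<infinity>]\<close>, which is the type \<^typ>\<open>ennreal\<close>. It is not a real vector space,
  so convexity is written out. The library product satisfies \<open>0 * \<infinity> = 0\<close>.
\<close>

definition young_function :: "(ennreal \<Rightarrow> ennreal) \<Rightarrow> bool" where
  "young_function \<Phi> \<longleftrightarrow>
     (\<forall>x y u v. u + v = 1 \<longrightarrow> \<Phi> (u * x + v * y) \<le> u * \<Phi> x + v * \<Phi> y) \<and>
     \<Phi> 0 = 0 \<and> ((\<lambda>t::real. \<Phi> (ennreal t)) \<longlongrightarrow> \<infinity>) at_top \<and> \<Phi> \<infinity> = \<infinity>"

text \<open>
  Subtraction on \<^typ>\<open>ennreal\<close> is truncated at 0. This does not change the supremum, because \<open>x = 0\<close>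
  already contributes 0. Only finite \<open>x\<close> are admitted (\<open>\<infinity> - \<infinity> = \<infinity>\<close> in the library).
\<close>

definition complementary :: "(ennreal \<Rightarrow> ennreal) \<Rightarrow> ennreal \<Rightarrow> ennreal" where
  "complementary \<Phi> y = (SUP x\<in>{x. x < \<infinity>}. x * y - \<Phi> x)"

definition complementary_young_pair :: "(ennreal \<Rightarrow> ennreal) \<Rightarrow> (ennreal \<Rightarrow> ennreal) \<Rightarrow> bool" where
  "complementary_young_pair \<Phi> \<Psi> \<longleftrightarrow> young_function \<Phi> \<and> \<Psi> = complementary \<Phi>"

definition local_Delta2 :: "(ennreal \<Rightarrow> ennreal) \<Rightarrow> bool" where
  "local_Delta2 \<Phi> \<longleftrightarrow>
     (\<exists>r>0. \<exists>C>0. \<forall>x::real. 0 \<le> x \<and> x \<le> r \<longrightarrow> \<Phi> (ennreal (2 * x)) \<le> ennreal C * \<Phi> (ennreal x))"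

text \<open>
  As usual for extended-valued convex functions, strictness is required on the effective domain
  \<open>{x. \<Phi> x < \<infinity>}\<close>; for \<open>\<Phi>\<close> finite on \<open>[0,\<infinity>)\<close> this is strict convexity on \<open>[0,\<infinity>)\<close>.
\<close>

definition strictly_convex :: "(ennreal \<Rightarrow> ennreal) \<Rightarrow> bool" where
  "strictly_convex \<Phi> \<longleftrightarrow>
     (\<forall>x y u v. x \<noteq> y \<and> x < \<infinity> \<and> y < \<infinity> \<and> \<Phi> x < \<infinity> \<and> \<Phi> y < \<infinity> \<and> 0 < u \<and> 0 < v \<and> u + v = 1
        \<longrightarrow> \<Phi> (u * x + v * y) < u * \<Phi> x + v * \<Phi> y)"

text \<open>\<open>\<Psi> \<lesssim> \<Phi>\<close> on \<open>[0, x\<^sub>0]\<close>\<close>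

definition dominated_near_0 :: "real \<Rightarrow> (ennreal \<Rightarrow> ennreal) \<Rightarrow> (ennreal \<Rightarrow> ennreal) \<Rightarrow> bool" where
  "dominated_near_0 x\<^sub>0 \<Psi> \<Phi> \<longleftrightarrow>
     (\<exists>C>0. \<forall>x::real. 0 \<le> x \<and> x \<le> x\<^sub>0 \<longrightarrow> \<Psi> (ennreal x) \<le> ennreal C * \<Phi> (ennreal x))"


section \<open>Orlicz and mixed Orlicz spaces\<close>

text \<open>
  The Luxemburg norm takes the modulus of a function as its argument. The modulus may be infinite,
  as the inner norm of the mixed norm can be.
\<close>

definition luxemburg_norm :: "(ennreal \<Rightarrow> ennreal) \<Rightarrow> 'a measure \<Rightarrow> ('a \<Rightarrow> ennreal) \<Rightarrow> ennreal" where
  "luxemburg_norm \<Phi> M f =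
     Inf {ennreal b | b::real. b > 0 \<and> (\<integral>\<^sup>+x. \<Phi> (f x / ennreal b) \<partial>M) \<le> 1}"

text \<open>
  \<open>\<int>\<^sup>n\<close> is \<^typ>\<open>int ^ 'n\<close>. The torus \<open>\<real>\<^sup>n/\<int>\<^sup>n\<close> is represented by its fundamental domain \<open>[0,1)\<^sup>n\<close>, on which
  normalized Haar measure is Lebesgue measure.
\<close>

definition torus :: "(real ^ 'n::finite) measure" where
  "torus = restrict_space lborel {w. \<forall>i. 0 \<le> w $ i \<and> w $ i < 1}"

definition mixed_norm ::
    "(ennreal \<Rightarrow> ennreal) \<Rightarrow> (ennreal \<Rightarrow> ennreal) \<Rightarrow> ((int ^ 'n::finite) \<times> (real ^ 'n) \<Rightarrow> complex) \<Rightarrow> ennreal" where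
  "mixed_norm \<Phi>\<^sub>1 \<Phi>\<^sub>2 F =
     luxemburg_norm \<Phi>\<^sub>2 torus
       (\<lambda>w. luxemburg_norm \<Phi>\<^sub>1 (count_space UNIV) (\<lambda>m. ennreal (cmod (F (m, w)))))"

definition mixed_orlicz ::
    "(ennreal \<Rightarrow> ennreal) \<Rightarrow> (ennreal \<Rightarrow> ennreal) \<Rightarrow> ((int ^ 'n::finite) \<times> (real ^ 'n) \<Rightarrow> complex) set" where
  "mixed_orlicz \<Phi>\<^sub>1 \<Phi>\<^sub>2 =
     {F \<in> borel_measurable (count_space UNIV \<Otimes>\<^sub>M torus). mixed_norm \<Phi>\<^sub>1 \<Phi>\<^sub>2 F < \<infinity>}"


section \<open>Rapidly decreasing functions and tempered distributions on the lattice\<close>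

definition real_vec :: "int ^ 'n \<Rightarrow> real ^ 'n::finite" where
  "real_vec k = (\<chi> i. real_of_int (k $ i))"

definition schwartz :: "(int ^ 'n::finite \<Rightarrow> complex) set" where
  "schwartz = {g. \<forall>M::nat. \<exists>C. \<forall>k. cmod (g k) \<le> C / (1 + norm (real_vec k)) ^ M}"

definition schwartz_seminorm :: "nat \<Rightarrow> (int ^ 'n::finite \<Rightarrow> complex) \<Rightarrow> real" where
  "schwartz_seminorm j g = (SUP k. (1 + norm (real_vec k)) ^ j * cmod (g k))"

definition lattice_pairing :: "(int ^ 'n::finite \<Rightarrow> complex) \<Rightarrow> (int ^ 'n \<Rightarrow> complex) \<Rightarrow> complex" where
  "lattice_pairing f g = (\<Sum>\<^sub>\<infinity>k. f k * cnj (g k))"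

text \<open>
  The dual of the Schwartz space. A continuous functional \<open>u\<close> is identified with the function
  \<open>f k = u \<delta>\<^sub>k\<close> on the lattice, which determines it (finitely supported functions are dense) and through
  which it acts by \<open>g \<mapsto> \<Sum>k. f k * cnj (g k)\<close>. The seminorms increase with \<open>j\<close>, so continuity means
  domination by a multiple of a single one of them.
\<close>

definition tempered :: "(int ^ 'n::finite \<Rightarrow> complex) set" where
  "tempered =
     {f. (\<forall>g\<in>schwartz. (\<lambda>k. f k * cnj (g k)) summable_on UNIV) \<and>
         (\<exists>C j. \<forall>g\<in>schwartz. cmod (lattice_pairing f g) \<le> C * schwartz_seminorm j g)}"


section \<open>Short-time Fourier transform and modulation spaces\<close>

definition translation :: "int ^ 'n::finite \<Rightarrow> (int ^ 'n \<Rightarrow> complex) \<Rightarrow> int ^ 'n \<Rightarrow> complex" where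
  "translation k f = (\<lambda>m. f (m - k))"

definition modulation :: "real ^ 'n::finite \<Rightarrow> (int ^ 'n \<Rightarrow> complex) \<Rightarrow> int ^ 'n \<Rightarrow> complex" where
  "modulation w f = (\<lambda>m. cis (2 * pi * (w \<bullet> real_vec m)) * f m)"

definition stft ::
    "(int ^ 'n::finite \<Rightarrow> complex) \<Rightarrow> (int ^ 'n \<Rightarrow> complex) \<Rightarrow> (int ^ 'n) \<times> (real ^ 'n) \<Rightarrow> complex" where
  "stft g f = (\<lambda>(m, w). lattice_pairing f (modulation w (translation m g)))"

definition modulation_norm ::
    "(int ^ 'n::finite \<Rightarrow> complex) \<Rightarrow> (ennreal \<Rightarrow> ennreal) \<Rightarrow> (ennreal \<Rightarrow> ennreal)
      \<Rightarrow> (int ^ 'n \<Rightarrow> complex) \<Rightarrow> ennreal" where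
  "modulation_norm g\<^sub>0 \<Phi>\<^sub>1 \<Phi>\<^sub>2 f = mixed_norm \<Phi>\<^sub>1 \<Phi>\<^sub>2 (stft g\<^sub>0 f)"

definition modulation_space ::
    "(int ^ 'n::finite \<Rightarrow> complex) \<Rightarrow> (ennreal \<Rightarrow> ennreal) \<Rightarrow> (ennreal \<Rightarrow> ennreal)
      \<Rightarrow> (int ^ 'n \<Rightarrow> complex) set" where
  "modulation_space g\<^sub>0 \<Phi>\<^sub>1 \<Phi>\<^sub>2 = {f \<in> tempered. stft g\<^sub>0 f \<in> mixed_orlicz \<Phi>\<^sub>1 \<Phi>\<^sub>2}"

text \<open>
  The pairing \<open>\<langle>f, h\<rangle>\<close> through which the modulation space of the complementary functions is the dual.
\<close>

definition duality_pairing ::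
    "(int ^ 'n::finite \<Rightarrow> complex) \<Rightarrow> (int ^ 'n \<Rightarrow> complex) \<Rightarrow> (int ^ 'n \<Rightarrow> complex) \<Rightarrow> complex" where
  "duality_pairing g\<^sub>0 f h =
     (\<Sum>\<^sub>\<infinity>m. \<integral>w. stft g\<^sub>0 f (m, w) * cnj (stft g\<^sub>0 h (m, w)) \<partial>torus)"


section \<open>Localization operators\<close>

definition localization_form ::
    "(int ^ 'n::finite \<Rightarrow> complex) \<Rightarrow> (int ^ 'n \<Rightarrow> complex) \<Rightarrow> ((int ^ 'n) \<times> (real ^ 'n) \<Rightarrow> complex)
      \<Rightarrow> (int ^ 'n \<Rightarrow> complex) \<Rightarrow> (int ^ 'n \<Rightarrow> complex) \<Rightarrow> complex" where
  "localization_form g\<^sub>1 g\<^sub>2 \<sigma> f h =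
     (\<Sum>\<^sub>\<infinity>m. \<integral>w. \<sigma> (m, w) * stft g\<^sub>1 f (m, w) * cnj (stft g\<^sub>2 h (m, w)) \<partial>torus)"

text \<open>
  \<open>f\<close> is mapped to the element of the modulation space that represents the functional
  \<open>h \<mapsto> localization_form g\<^sub>1 g\<^sub>2 \<sigma> f h\<close>. The value is meaningful only if there is exactly one.
  The form scales with \<open>g\<^sub>1\<close> and \<open>g\<^sub>2\<close>, whereas the norm depends only on \<open>g\<^sub>0\<close>; hence an estimate of the operator
  norm by the norm of \<open>\<sigma>\<close> needs a constant that depends on the windows.
\<close>

definition localization_operator ::
    "(int ^ 'n::finite \<Rightarrow> complex) \<Rightarrow> (ennreal \<Rightarrow> ennreal) \<Rightarrow> (ennreal \<Rightarrow> ennreal)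
      \<Rightarrow> (ennreal \<Rightarrow> ennreal) \<Rightarrow> (ennreal \<Rightarrow> ennreal)
      \<Rightarrow> (int ^ 'n \<Rightarrow> complex) \<Rightarrow> (int ^ 'n \<Rightarrow> complex) \<Rightarrow> ((int ^ 'n) \<times> (real ^ 'n) \<Rightarrow> complex)
      \<Rightarrow> (int ^ 'n \<Rightarrow> complex) \<Rightarrow> (int ^ 'n \<Rightarrow> complex)" where
  "localization_operator g\<^sub>0 \<Phi>\<^sub>1 \<Phi>\<^sub>2 \<Psi>\<^sub>1 \<Psi>\<^sub>2 g\<^sub>1 g\<^sub>2 \<sigma> f =
     (THE u. u \<in> modulation_space g\<^sub>0 \<Phi>\<^sub>1 \<Phi>\<^sub>2 \<and>
        (\<forall>h\<in>modulation_space g\<^sub>0 \<Psi>\<^sub>1 \<Psi>\<^sub>2. duality_pairing g\<^sub>0 u h = localization_form g\<^sub>1 g\<^sub>2 \<sigma> f h))"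


section \<open>Bounded operators on a space of functions\<close>

definition bounded_operators ::
    "('a \<Rightarrow> complex) set \<Rightarrow> (('a \<Rightarrow> complex) \<Rightarrow> ennreal) \<Rightarrow> (('a \<Rightarrow> complex) \<Rightarrow> ('a \<Rightarrow> complex)) set" where
  "bounded_operators X N =
     {T. (\<forall>f\<in>X. T f \<in> X) \<and>
         (\<forall>f\<in>X. \<forall>h\<in>X. T (\<lambda>k. f k + h k) = (\<lambda>k. T f k + T h k)) \<and>
         (\<forall>f\<in>X. \<forall>c. T (\<lambda>k. c * f k) = (\<lambda>k. c * T f k)) \<and>
         (\<exists>K::real. \<forall>f\<in>X. N (T f) \<le> ennreal K * N f)}"

definition operator_norm ::
    "('a \<Rightarrow> complex) set \<Rightarrow> (('a \<Rightarrow> complex) \<Rightarrow> ennreal) \<Rightarrow> (('a \<Rightarrow> complex) \<Rightarrow> ('a \<Rightarrow> complex)) \<Rightarrow> ennreal" where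
  "operator_norm X N T = (SUP f\<in>{f \<in> X. N f \<le> 1}. N (T f))"

end

theory Submission
  imports Defs
begin

text \<open>
  Because the torus is compact, the modulation space is just the Orlicz sequence space of \<open>\<Phi>\<^sub>1\<close>,
  with equivalent norms. Indeed \<open>|V\<^sub>g f(m, w)|\<close> is at most a convolution of \<open>|f|\<close> with \<open>|g| \<in> \<ell>\<^sup>1\<close>,
  uniformly in \<open>w\<close>. Conversely, Fourier inversion in \<open>w\<close> recovers \<open>f(l) cnj (g(l - m))\<close> as an integral
  of \<open>V\<^sub>g f(m, \<cdot>)\<close> over the torus, and Minkowski's integral inequality together with the embedding
  of the Orlicz space of \<open>\<Phi>\<^sub>2\<close> on the torus into \<open>L\<^sup>1\<close> bounds \<open>f\<close>. By Parseval the duality pairing is a multiple of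
  \<open>\<Sum>k. u k * cnj (h k)\<close>, hence it separates points (test with delta functions), and by Fubini the
  localization form is represented by
  \<open>k \<mapsto> \<Sum>m. g\<^sub>2(k - m) \<integral> \<sigma>(m, w) V\<^bsub>g\<^sub>1\<^esub> f(m, w) e\<^bsup>2 \<pi> i w k\<^esup> dw\<close> up to the factor \<open>\<parallel>g\<^sub>0\<parallel>\<^sup>2\<close>.
  Since \<open>V\<^bsub>g\<^sub>1\<^esub> f\<close> is bounded by the norm of \<open>f\<close>, this sequence is dominated by a convolution of \<open>|g\<^sub>2|\<close>
  with \<open>m \<mapsto> \<integral> |\<sigma>(m, w)| dw\<close>, whose Orlicz norm is controlled by that of \<open>\<sigma>\<close>.
\<close>

section \<open>Luxemburg norms\<close>

text \<open>The operator is defined by \<open>THE\<close>, so neither its values nor its linearity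
  can be read off the definition. Everything is proved for the explicit sequence
  \<open>localization_synthesis\<close> and transferred once the pairing is known to separate
  points. For a star-shaped gauge the Luxemburg functional is handled as a norm only up to
  constants: Minkowski's inequality carries a factor 4, one 2 from halving the argument in Jensen's
  inequality and another from doubling a norm to get strictly above the infimum. Such losses are
  harmless because the final estimate contains a constant anyway; what matters is that it is uniform
  in the symbol and in \<open>f\<close>. For this reason the quantitative lemmas obtain their
  constant before they quantify over functions. The outer function \<open>\<Phi>\<^sub>2\<close>
  lives on a space of mass at most 1, where bounded functions embed into its Orlicz space and that
  space embeds into L^1; these two embeddings remove it from the mixed norm.\<close>

lemma pos_ennreal_divide_le_eq:
  fixes a b c :: ennreal
  assumes "0 < c" "c < \<infinity>"
  shows "a / c \<le> b \<longleftrightarrow> a \<le> b * c"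
proof -
  have "b < a / c \<longleftrightarrow> b * c < a"
    using assms by (cases a; cases b; cases c)
      (auto simp: divide_ennreal ennreal_mult[symmetric] ennreal_less_iff field_simps ennreal_top_mult ennreal_top_divide)
  then show ?thesis by (simp add: not_less[symmetric])
qed

lemma ennreal_divide_antimono: "b \<le> c \<Longrightarrow> x / c \<le> x / (b::ennreal)"
  unfolding divide_ennreal_def including ennreal.lifting
  by (intro mult_left_mono, transfer) (auto intro: ereal_inverse_antimono)

text \<open>
  Up to constants, all estimates need only star-shapedness at 0 instead of convexity, which is easier
  to verify for the complementary function.
\<close>

locale orlicz_gauge =
  fixes \<Phi> :: "ennreal \<Rightarrow> ennreal"
  assumes star: "u \<le> 1 \<Longrightarrow> \<Phi> (u * x) \<le> u * \<Phi> x"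
    and top: "\<Phi> \<infinity> = \<infinity>"
    and large: "\<exists>t::real. t > 0 \<and> 1 \<le> \<Phi> (ennreal t)"
    and small: "\<exists>t::real. t > 0 \<and> \<Phi> (ennreal t) \<le> 1"
    and measurable[measurable]: "\<Phi> \<in> borel_measurable borel"
begin

lemma zero: "\<Phi> 0 = 0"
  using star[of 0 0] by simp

text \<open>For \<open>y\<close> finite and non-zero, \<open>x\<close> is the multiple
  \<open>x / y\<close> of \<open>y\<close>, so star-shapedness applies with a factor at most
  1.\<close>

lemma mono: "x \<le> y \<Longrightarrow> \<Phi> x \<le> \<Phi> y"
proof -
  assume xy: "x \<le> y"
  consider "y = 0" | "y = \<infinity>" | "y \<noteq> 0" "y \<noteq> \<infinity>" by blast
  then show ?thesis
  proof cases
    case 3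
    have "x / y \<le> 1" using xy 3 by (simp add: divide_le_posI_ennreal pos_ennreal_divide_le_eq zero_less_iff_neq_zero)
    moreover have "x / y * y = x" using 3 xy by (simp add: ennreal_divide_times ennreal_divide_self top.not_eq_extremum)
    ultimately have "\<Phi> x \<le> x / y * \<Phi> y" using star[of "x / y" y] by simp
    also have "\<dots> \<le> 1 * \<Phi> y" by (rule mult_right_mono) (use \<open>x / y \<le> 1\<close> in auto)
    finally show ?thesis by simp
  qed (use xy top zero in auto)
qed

text \<open>The quotient \<open>\<Phi> x / x\<close> does not decrease, written without division so
  that \<open>x = 0\<close> and infinite values of \<open>\<Phi>\<close> are covered.\<close>

lemma star_le: "t \<le> x \<Longrightarrow> x < \<infinity> \<Longrightarrow> \<Phi> t * x \<le> t * \<Phi> x"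
proof (cases "x = 0")
  case False
  assume tx: "t \<le> x" "x < \<infinity>"
  have "t / x \<le> 1" using tx False by (simp add: pos_ennreal_divide_le_eq zero_less_iff_neq_zero)
  moreover have "t / x * x = t" using False tx by (simp add: ennreal_divide_times ennreal_divide_self)
  ultimately have "\<Phi> t \<le> t / x * \<Phi> x" using star[of "t / x" x] by simp
  then have "\<Phi> t * x \<le> t / x * \<Phi> x * x" by (rule mult_right_mono) auto
  also have "\<dots> = t / x * x * \<Phi> x" by (simp add: ac_simps)
  finally show ?thesis using \<open>t / x * x = t\<close> by simp
qed auto

text \<open>
  A substitute for the supporting line at \<open>t\<close>: integrated with \<open>t\<close> equal to half the mean, it gives
  Jensen's inequality up to a factor 2 in the argument.
\<close>

lemma affine_bound:
  assumes "0 < t" "t < \<infinity>" "K \<le> \<Phi> t"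
  shows "K * x \<le> t * (\<Phi> x + K)"
proof -
  consider "x \<le> t" | "t < x" "x < \<infinity>" | "x = \<infinity>" by (metis linorder_not_le top.not_eq_extremum infinity_ennreal_def)
  then show ?thesis
  proof cases
    case 1
    have "K * x \<le> K * t" using 1 by (intro mult_left_mono) auto
    also have "\<dots> \<le> t * (\<Phi> x + K)" by (simp add: distrib_left mult.commute)
    finally show ?thesis .
  next
    case 2
    have "K * x \<le> \<Phi> t * x" using assms by (intro mult_right_mono) auto
    also have "\<dots> \<le> t * \<Phi> x" using star_le 2 by simp
    also have "\<dots> \<le> t * (\<Phi> x + K)" by (simp add: distrib_left)
    finally show ?thesis .
  next
    case 3
    then show ?thesis using assms top by (simp add: ennreal_mult_top)
  qed
qed

lemma luxemburg_leI: "b > 0 \<Longrightarrow> (\<integral>\<^sup>+x. \<Phi> (f x / ennreal b) \<partial>M) \<le> 1 \<Longrightarrow> luxemburg_norm \<Phi> M f \<le> ennreal b"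
  unfolding luxemburg_norm_def by (rule Inf_lower) auto

text \<open>The infimum defining the norm need not be attained, but every strictly larger
  \<open>b\<close> is admissible because \<open>\<Phi>\<close> is monotone. Hence the factor 2 that
  later lifts a norm above itself.\<close>

lemma luxemburg_lessD:
  assumes "luxemburg_norm \<Phi> M f < ennreal b"
  shows "(\<integral>\<^sup>+x. \<Phi> (f x / ennreal b) \<partial>M) \<le> 1"
proof -
  obtain c where c: "c > 0" "(\<integral>\<^sup>+x. \<Phi> (f x / ennreal c) \<partial>M) \<le> 1" "ennreal c < ennreal b"
    using assms unfolding luxemburg_norm_def Inf_less_iff by auto
  have "(\<integral>\<^sup>+x. \<Phi> (f x / ennreal b) \<partial>M) \<le> (\<integral>\<^sup>+x. \<Phi> (f x / ennreal c) \<partial>M)"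
    using c by (intro nn_integral_mono mono ennreal_divide_antimono) auto
  with c show ?thesis by auto
qed

lemma luxemburg_mono:
  assumes "\<And>x. x \<in> space M \<Longrightarrow> f x \<le> g x"
  shows "luxemburg_norm \<Phi> M f \<le> luxemburg_norm \<Phi> M g"
  unfolding luxemburg_norm_def
proof (rule Inf_superset_mono, safe)
  fix b :: real assume b: "0 < b" "(\<integral>\<^sup>+x. \<Phi> (g x / ennreal b) \<partial>M) \<le> 1"
  have "(\<integral>\<^sup>+x. \<Phi> (f x / ennreal b) \<partial>M) \<le> (\<integral>\<^sup>+x. \<Phi> (g x / ennreal b) \<partial>M)"
    using assms by (intro nn_integral_mono mono divide_right_mono_ennreal) auto
  with b show "\<exists>ba. ennreal b = ennreal ba \<and> ba > 0 \<and> (\<integral>\<^sup>+x. \<Phi> (f x / ennreal ba) \<partial>M) \<le> 1" by auto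
qed

lemma luxemburg_zero: "luxemburg_norm \<Phi> M (\<lambda>_. 0) = 0"
proof -
  have "luxemburg_norm \<Phi> M (\<lambda>_. 0) \<le> 0 + ennreal e" if "e > 0" for e
    using luxemburg_leI[of e M "\<lambda>_. 0"] that zero by simp
  then have "luxemburg_norm \<Phi> M (\<lambda>_. 0) \<le> 0" by (rule ennreal_le_epsilon)
  then show ?thesis by simp
qed

lemma luxemburg_cmult_le:
  assumes "c \<ge> 0"
  shows "luxemburg_norm \<Phi> M (\<lambda>x. ennreal c * f x) \<le> ennreal c * luxemburg_norm \<Phi> M f"
proof (cases "c = 0")
  case False
  then have c: "c > 0" using assms by simp
  have "luxemburg_norm \<Phi> M (\<lambda>x. ennreal c * f x) / ennreal c \<le> luxemburg_norm \<Phi> M f"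
    unfolding luxemburg_norm_def[of \<Phi> M f]
  proof (rule Inf_greatest, safe)
    fix b :: real assume b: "b > 0" "(\<integral>\<^sup>+x. \<Phi> (f x / ennreal b) \<partial>M) \<le> 1"
    have "ennreal c * f x / ennreal (c * b) = f x / ennreal b" for x
      using c b divide_mult_eq[of "ennreal c" "f x" "ennreal b"] by (simp add: ennreal_mult mult.commute)
    then have "luxemburg_norm \<Phi> M (\<lambda>x. ennreal c * f x) \<le> ennreal (c * b)"
      using b c by (intro luxemburg_leI) auto
    then show "luxemburg_norm \<Phi> M (\<lambda>x. ennreal c * f x) / ennreal c \<le> ennreal b"
      using c by (subst pos_ennreal_divide_le_eq) (use b in \<open>auto simp: ennreal_mult mult.commute\<close>)
  qed
  then show ?thesis
    using c by (subst (asm) pos_ennreal_divide_le_eq) (auto simp: mult.commute)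
qed (simp add: luxemburg_zero)

section \<open>Embeddings between Orlicz spaces, bounded functions and integrable functions\<close>

text \<open>Star-shapedness makes \<open>\<Phi>\<close> grow at least linearly beyond
  \<open>t\<close>. The affine form serves integrals, the form for \<open>\<Phi> x \<le> 1\<close>
  serves pointwise bounds.\<close>

lemma large_imp_le:
  assumes "t > 0" "1 \<le> \<Phi> (ennreal t)"
  shows "x \<le> ennreal t * (1 + \<Phi> x)" and "\<Phi> x \<le> 1 \<Longrightarrow> x \<le> ennreal t"
proof -
  have t: "0 < ennreal t" "ennreal t < \<infinity>" using assms by auto
  show "x \<le> ennreal t * (1 + \<Phi> x)" using affine_bound[OF t assms(2), of x] by (simp add: add.commute)
  show "x \<le> ennreal t" if "\<Phi> x \<le> 1"
  proof (cases "x \<le> ennreal t")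
    case False
    have "x \<noteq> \<infinity>" using that top by (metis ennreal_one_less_top infinity_ennreal_def linorder_not_less)
    then have "x < \<infinity>" by (simp add: top.not_eq_extremum)
    then have "\<Phi> (ennreal t) * x \<le> ennreal t * \<Phi> x" using False star_le by simp
    moreover have "1 * x \<le> \<Phi> (ennreal t) * x" using assms by (intro mult_right_mono) auto
    moreover have "ennreal t * \<Phi> x \<le> ennreal t * 1" using that by (intro mult_left_mono) auto
    ultimately show ?thesis by simp
  qed
qed

text \<open>Over a counting measure a single term of the modular is at most the whole sum, hence at
  most 1 for every admissible \<open>b\<close>. This is the embedding into bounded
  sequences.\<close>

lemma le_luxemburg:
  assumes "t > 0" "1 \<le> \<Phi> (ennreal t)"
  shows "f m \<le> ennreal t * luxemburg_norm \<Phi> (count_space UNIV) f"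
proof -
  have "f m / ennreal t \<le> luxemburg_norm \<Phi> (count_space UNIV) f"
    unfolding luxemburg_norm_def
  proof (rule Inf_greatest, safe)
    fix b :: real assume b: "b > 0" "(\<integral>\<^sup>+x. \<Phi> (f x / ennreal b) \<partial>count_space UNIV) \<le> 1"
    have "\<Phi> (f m / ennreal b) \<le> (\<integral>\<^sup>+x. \<Phi> (f x / ennreal b) \<partial>count_space UNIV)"
      by (rule nn_integral_ge_point) simp
    then have "f m / ennreal b \<le> ennreal t" using b large_imp_le(2)[OF assms] by auto
    then have "f m \<le> ennreal t * ennreal b" using b by (simp add: pos_ennreal_divide_le_eq)
    then show "f m / ennreal t \<le> ennreal b"
      using assms by (subst pos_ennreal_divide_le_eq) (auto simp: mult.commute)
  qed
  then show ?thesis using assms by (subst (asm) pos_ennreal_divide_le_eq) (auto simp: mult.commute)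
qed

text \<open>The affine bound of \<open>large_imp_le\<close> is integrated; total mass and modular
  are each at most 1, which is the 2 in the constant.\<close>

lemma nn_integral_le_luxemburg:
  assumes "t > 0" "1 \<le> \<Phi> (ennreal t)" "emeasure M (space M) \<le> 1"
    and [measurable]: "f \<in> borel_measurable M"
  shows "(\<integral>\<^sup>+x. f x \<partial>M) \<le> ennreal (2 * t) * luxemburg_norm \<Phi> M f"
proof -
  have "(\<integral>\<^sup>+x. f x \<partial>M) / ennreal (2 * t) \<le> luxemburg_norm \<Phi> M f"
    unfolding luxemburg_norm_def
  proof (rule Inf_greatest, safe)
    fix b :: real assume b: "b > 0" "(\<integral>\<^sup>+x. \<Phi> (f x / ennreal b) \<partial>M) \<le> 1"
    have "f x \<le> ennreal (t * b) * (1 + \<Phi> (f x / ennreal b))" for x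
      using large_imp_le(1)[OF assms(1,2), of "f x / ennreal b"] b assms(1)
      by (subst (asm) pos_ennreal_divide_le_eq) (auto simp: ennreal_mult ac_simps)
    then have "(\<integral>\<^sup>+x. f x \<partial>M) \<le> (\<integral>\<^sup>+x. ennreal (t * b) * (1 + \<Phi> (f x / ennreal b)) \<partial>M)"
      by (intro nn_integral_mono)
    also have "\<dots> = ennreal (t * b) * (emeasure M (space M) + (\<integral>\<^sup>+x. \<Phi> (f x / ennreal b) \<partial>M))"
      by (simp add: nn_integral_cmult nn_integral_add)
    also have "\<dots> \<le> ennreal (t * b) * (1 + 1)" using b assms by (intro mult_left_mono add_mono) auto
    also have "\<dots> = ennreal b * ennreal (2 * t)" using b assms
      by (simp add: ennreal_mult one_add_one ac_simps)
    finally show "(\<integral>\<^sup>+x. f x \<partial>M) / ennreal (2 * t) \<le> ennreal b"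
      using assms b by (subst pos_ennreal_divide_le_eq) auto
  qed
  then show ?thesis using assms by (subst (asm) pos_ennreal_divide_le_eq) (auto simp: mult.commute)
qed

text \<open>With a divisor slightly above \<open>c / t\<close> the argument of \<open>\<Phi>\<close>
  stays below \<open>t\<close>, so the modular is at most the total mass.\<close>

lemma luxemburg_const_le:
  assumes "t > 0" "\<Phi> (ennreal t) \<le> 1" "emeasure M (space M) \<le> 1" "\<And>x. x \<in> space M \<Longrightarrow> f x \<le> c"
  shows "luxemburg_norm \<Phi> M f \<le> ennreal (1 / t) * c"
proof (cases "c = \<infinity>")
  case True
  then show ?thesis using assms by (simp add: ennreal_mult_top)
next
  case False
  then obtain r where r: "c = ennreal r" "r \<ge> 0" by (cases c) auto
  \<comment> \<open>The extra \<open>e\<close> keeps the divisor \<open>r / t + e\<close> positive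
    also for \<open>r = 0\<close>.\<close>
  have "luxemburg_norm \<Phi> M f \<le> ennreal (1 / t) * c + ennreal e" if e: "e > 0" for e
  proof -
    have pos: "0 < r / t + e" using r e assms by (intro add_nonneg_pos) auto
    have "r \<le> t * (r / t + e)" using r e assms by (simp add: distrib_left)
    then have le: "r / (r / t + e) \<le> t" using pos by (simp add: pos_divide_le_eq)
    have "\<Phi> (f x / ennreal (r / t + e)) \<le> 1" if "x \<in> space M" for x
    proof -
      have "f x / ennreal (r / t + e) \<le> ennreal r / ennreal (r / t + e)"
        using assms(4)[OF that] r by (intro divide_right_mono_ennreal) auto
      also have "\<dots> = ennreal (r / (r / t + e))" using r pos by (rule_tac divide_ennreal)
      also have "\<dots> \<le> ennreal t" using le by (rule ennreal_leI)
      finally show ?thesis using mono assms(2) order_trans by blast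
    qed
    then have "(\<integral>\<^sup>+x. \<Phi> (f x / ennreal (r / t + e)) \<partial>M) \<le> (\<integral>\<^sup>+x. 1 \<partial>M)"
      by (intro nn_integral_mono) auto
    also have "\<dots> \<le> 1" using assms by simp
    finally have "luxemburg_norm \<Phi> M f \<le> ennreal (r / t + e)"
      using pos by (intro luxemburg_leI) auto
    also have "\<dots> = ennreal (1 / t) * c + ennreal e"
      using r e assms by (simp add: ennreal_mult'[symmetric] flip: ennreal_plus)
    finally show ?thesis .
  qed
  then show ?thesis by (rule ennreal_le_epsilon)
qed

lemma luxemburg_bij:
  assumes "bij p"
  shows "luxemburg_norm \<Phi> (count_space UNIV) (\<lambda>x. f (p x)) = luxemburg_norm \<Phi> (count_space UNIV) f"
  unfolding luxemburg_norm_def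
  using nn_integral_bij_count_space[OF assms, where f = "\<lambda>x. \<Phi> (f x / _)"] by simp

text \<open>The infimum ranges over uncountably many radii; monotonicity in the radius lets rational
  ones describe the strict sublevel sets, which become countable unions.\<close>

lemma luxemburg_measurable:
  fixes a :: "'w \<Rightarrow> 'm::countable \<Rightarrow> ennreal"
  assumes [measurable]: "\<And>m. (\<lambda>w. a w m) \<in> borel_measurable M"
  shows "(\<lambda>w. luxemburg_norm \<Phi> (count_space UNIV) (a w)) \<in> borel_measurable M"
proof (rule borel_measurableI_less)
  fix y :: ennreal
  let ?I = "\<lambda>q w. \<integral>\<^sup>+m. \<Phi> (a w m / ennreal (real_of_rat q)) \<partial>count_space UNIV"
  have [measurable]: "?I q \<in> borel_measurable M" for q
  proof -
    interpret sigma_finite_measure "count_space (UNIV::'m set)" by (rule sigma_finite_measure_count_space)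
    have "(\<lambda>(w, m). \<Phi> (a w m / ennreal (real_of_rat q))) \<in> borel_measurable (M \<Otimes>\<^sub>M count_space UNIV)"
      unfolding split_beta
      by (rule measurable_compose_countable'[where f = "\<lambda>m x. \<Phi> (a (fst x) m / ennreal (real_of_rat q))" and g = snd and I = UNIV])
        (auto simp: countableI_type)
    then show ?thesis by (rule borel_measurable_nn_integral)
  qed
  have "{w \<in> space M. luxemburg_norm \<Phi> (count_space UNIV) (a w) < y}
      = (\<Union>q\<in>{q::rat. q > 0 \<and> ennreal (real_of_rat q) < y}. {w \<in> space M. ?I q w \<le> 1})" (is "?L = ?R")
  proof
    show "?R \<subseteq> ?L"
    proof safe
      fix w and q :: rat assume q: "q > 0" "ennreal (real_of_rat q) < y" "?I q w \<le> 1"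
      then have "luxemburg_norm \<Phi> (count_space UNIV) (a w) \<le> ennreal (real_of_rat q)"
        by (intro luxemburg_leI) auto
      then show "luxemburg_norm \<Phi> (count_space UNIV) (a w) < y" using q(2) by (rule le_less_trans)
    qed
    show "?L \<subseteq> ?R"
    proof safe
      fix w assume w: "w \<in> space M" "luxemburg_norm \<Phi> (count_space UNIV) (a w) < y"
      then obtain b :: real where b: "b > 0" "ennreal b < y" "luxemburg_norm \<Phi> (count_space UNIV) (a w) < ennreal b"
      proof -
        obtain z where z: "luxemburg_norm \<Phi> (count_space UNIV) (a w) < z" "z < y" using dense w by blast
        then obtain r where r: "z = ennreal r" "r \<ge> 0" by (cases z) auto
        moreover from this z have "r \<noteq> 0" by auto
        ultimately show ?thesis using z that[of r] by simp
      qed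
      obtain z where z: "ennreal b < z" "z < y" using dense b by blast
      then obtain r where r: "z = ennreal r" "r \<ge> 0" by (cases z) auto
      then have "b < r" using z b by (simp add: ennreal_less_iff)
      then obtain q where q: "b < real_of_rat q" "real_of_rat q < r" using of_rat_dense by blast
      have "luxemburg_norm \<Phi> (count_space UNIV) (a w) < ennreal (real_of_rat q)"
        using b q by (auto simp: ennreal_less_iff intro: less_trans)
      then have "?I q w \<le> 1" by (rule luxemburg_lessD)
      moreover have "real_of_rat q > 0" using b q by linarith
      moreover have "ennreal (real_of_rat q) < y"
        using q r z by (metis ennreal_leI less_imp_le order_le_less_trans)
      ultimately show "w \<in> ?R" using w by (auto simp: zero_less_of_rat_iff)
    qed
  qed
  also have "\<dots> \<in> sets M" by measurable
  finally show "{w \<in> space M. luxemburg_norm \<Phi> (count_space UNIV) (a w) < y} \<in> sets M" .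
qed

end

section \<open>Minkowski's integral inequality and convolution with summable kernels\<close>

context orlicz_gauge begin

text \<open>The slices are normalised by \<open>n w\<close>, twice their norm, and averaged against
  the weight \<open>n w / N\<close>, whose total mass is 1. Jensen's inequality bounds
  \<open>\<Phi>\<close> of half the average by the average of \<open>\<Phi> (a w m / n w)\<close>;
  after an interchange, the sum over \<open>m\<close> lets each slice contribute at most its weight.
  The 4 is the doubling of the norm times the halving in Jensen's inequality.\<close>

lemma luxemburg_minkowski:
  fixes a :: "'w \<Rightarrow> 'm::countable \<Rightarrow> ennreal"
  assumes meas[measurable]: "\<And>m. (\<lambda>w. a w m) \<in> borel_measurable M"
  shows "luxemburg_norm \<Phi> (count_space UNIV) (\<lambda>m. \<integral>\<^sup>+w. a w m \<partial>M)
    \<le> 4 * (\<integral>\<^sup>+w. luxemburg_norm \<Phi> (count_space UNIV) (a w) \<partial>M)"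
proof -
  define l where "l w = luxemburg_norm \<Phi> (count_space UNIV) (a w)" for w
  define n where "n w = 2 * l w" for w
  define N where "N = (\<integral>\<^sup>+w. n w \<partial>M)"
  define A where "A m = (\<integral>\<^sup>+w. a w m \<partial>M)" for m
  have [measurable]: "l \<in> borel_measurable M" unfolding l_def[abs_def] by (rule luxemburg_measurable) fact
  have [measurable]: "n \<in> borel_measurable M" unfolding n_def[abs_def] by simp
  obtain t0 :: real where t0: "t0 > 0" "1 \<le> \<Phi> (ennreal t0)" using large by auto
  have N4: "4 * (\<integral>\<^sup>+w. l w \<partial>M) = 2 * N"
  proof -
    have "2 * N = 2 * 2 * (\<integral>\<^sup>+w. l w \<partial>M)" unfolding N_def n_def by (subst nn_integral_cmult) (auto simp: mult.assoc)
    then show ?thesis by simp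
  qed
  \<comment> \<open>This makes \<open>a\<close> vanish where \<open>n\<close> does, and
    \<open>A\<close> finite when \<open>N\<close> is.\<close>
  have a_le: "a w m \<le> ennreal t0 * n w" for w m
  proof -
    have "a w m \<le> ennreal t0 * l w" unfolding l_def using le_luxemburg[OF t0] .
    also have "\<dots> \<le> ennreal t0 * n w" unfolding n_def mult_2 by (intro mult_left_mono) auto
    finally show ?thesis .
  qed
  have A_le: "A m \<le> ennreal t0 * N" for m
  proof -
    have "A m \<le> (\<integral>\<^sup>+w. ennreal t0 * n w \<partial>M)" unfolding A_def using a_le by (intro nn_integral_mono)
    then show ?thesis unfolding N_def by (simp add: nn_integral_cmult)
  qed
  have "luxemburg_norm \<Phi> (count_space UNIV) A \<le> 2 * N"
  proof -
    consider "N = \<infinity>" | "N = 0" | "N \<noteq> 0" "N \<noteq> \<infinity>" by blast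
    then show ?thesis
    proof cases
      case 1
      then show ?thesis by (simp add: ennreal_mult_top)
    next
      case 2
      then have "A = (\<lambda>_. 0)" using A_le by auto
      then show ?thesis by (simp add: luxemburg_zero)
    next
      case 3
      then obtain r where r: "N = ennreal r" "r > 0" by (cases N) (auto simp: less_le)
      have N0: "0 < N" "N < \<infinity>" using r by auto
      have fin: "AE w in M. n w \<noteq> \<infinity>" using 3 unfolding N_def by (intro nn_integral_PInf_AE) auto
      \<comment> \<open>Half of the weighted mean \<open>A m / N\<close> of the quotients
        \<open>a w m / n w\<close>; the half is the price for \<open>affine_bound\<close> in place
        of a supporting line.\<close>
      define t where "t m = A m / (2 * N)" for m
      have jensen: "\<Phi> (t m) \<le> (\<integral>\<^sup>+w. \<Phi> (a w m / n w) * n w \<partial>M) / N" for m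
      proof (rule dense_le)
        \<comment> \<open>\<open>\<Phi> (t m)\<close> may be infinite; a finite \<open>K\<close>
          below it keeps \<open>K * N\<close> finite and thus cancellable.\<close>
        fix K assume "K < \<Phi> (t m)"
        then have K: "K \<le> \<Phi> (t m)" "K < \<infinity>" by (auto simp: order.strict_implies_order intro: order.strict_trans2[where b = "\<Phi> (t m)"])
        have tpos: "0 < t m" using \<open>K < \<Phi> (t m)\<close> zero by (metis gr_zeroI not_less_zero)
        have "A m < \<infinity>" using A_le[of m] r t0 by (auto simp: ennreal_mult[symmetric] intro: le_less_trans)
        then have tfin: "t m < \<infinity>" using r unfolding t_def
          by (simp add: ennreal_divide_eq_top_iff top.not_eq_extremum[symmetric])
        have A_eq: "A m = 2 * N * t m"
          unfolding t_def using r by (simp add: ennreal_times_divide mult_divide_eq_ennreal ennreal_mult_eq_top_iff mult.commute)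
        let ?I = "\<integral>\<^sup>+w. \<Phi> (a w m / n w) * n w \<partial>M"
        have pt: "AE w in M. K * a w m \<le> t m * (\<Phi> (a w m / n w) * n w + K * n w)"
          using fin
        proof eventually_elim
          fix w assume w: "n w \<noteq> \<infinity>"
          show "K * a w m \<le> t m * (\<Phi> (a w m / n w) * n w + K * n w)"
          proof (cases "n w = 0")
            case True
            then show ?thesis using a_le[of w m] by simp
          next
            case False
            have "K * (a w m / n w) * n w \<le> t m * (\<Phi> (a w m / n w) + K) * n w"
              using affine_bound[OF tpos tfin K(1)] by (intro mult_right_mono) auto
            moreover have "K * (a w m / n w) * n w = K * a w m"
              using False w by (simp add: mult.assoc ennreal_divide_times ennreal_divide_self top.not_eq_extremum)
            ultimately show ?thesis by (simp add: algebra_simps)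
          qed
        qed
        have "K * A m = (\<integral>\<^sup>+w. K * a w m \<partial>M)" unfolding A_def by (simp add: nn_integral_cmult)
        also have "\<dots> \<le> (\<integral>\<^sup>+w. t m * (\<Phi> (a w m / n w) * n w + K * n w) \<partial>M)"
          using pt by (rule nn_integral_mono_AE)
        also have "\<dots> = t m * (?I + K * N)"
          unfolding N_def by (simp add: nn_integral_cmult nn_integral_add)
        \<comment> \<open>Since \<open>A m = 2 * N * t m\<close>, the left side counts
          \<open>K * N\<close> twice; one copy cancels the error term on the right.\<close>
        finally have "t m * (2 * K * N) \<le> t m * (?I + K * N)" unfolding A_eq by (simp add: ac_simps)
        then have "2 * K * N \<le> ?I + K * N"
          using tpos tfin by (subst (asm) ennreal_mult_le_mult_iff) auto
        then have "K * N + K * N \<le> K * N + ?I" by (simp only: mult_2 distrib_right add.commute)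
        moreover have "K * N \<noteq> \<infinity>" using K(2) r by (simp add: ennreal_mult_eq_top_iff)
        ultimately have "K * N \<le> ?I" unfolding ennreal_add_left_cancel_le by auto
        then have "K * N / N \<le> ?I / N" by (rule divide_right_mono_ennreal)
        then show "K \<le> ?I / N" using N0 by (simp add: mult_divide_eq_ennreal)
      qed
      have "(\<integral>\<^sup>+m. \<Phi> (t m) \<partial>count_space UNIV)
          \<le> (\<integral>\<^sup>+m. (\<integral>\<^sup>+w. \<Phi> (a w m / n w) * n w \<partial>M) / N \<partial>count_space UNIV)"
        using jensen by (intro nn_integral_mono)
      also have "\<dots> = (\<integral>\<^sup>+m. (\<integral>\<^sup>+w. \<Phi> (a w m / n w) * n w \<partial>M) \<partial>count_space UNIV) / N"
        by (rule nn_integral_divide) simp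
      also have "\<dots> = (\<integral>\<^sup>+w. (\<integral>\<^sup>+m. \<Phi> (a w m / n w) * n w \<partial>count_space UNIV) \<partial>M) / N"
        by (subst nn_integral_count_space_nn_integral) auto
      also have "\<dots> \<le> (\<integral>\<^sup>+w. n w \<partial>M) / N"
      proof (rule divide_right_mono_ennreal, rule nn_integral_mono_AE, use fin in eventually_elim)
        fix w assume w: "n w \<noteq> \<infinity>"
        show "(\<integral>\<^sup>+m. \<Phi> (a w m / n w) * n w \<partial>count_space UNIV) \<le> n w"
        proof (cases "n w = 0")
          case False
          then obtain b where b: "n w = ennreal b" "b > 0" using w by (cases "n w") (auto simp: less_le)
          \<comment> \<open>The doubling in \<open>n w\<close> is used here: it lies strictly above
            the norm of the slice, so the modular at radius \<open>n w\<close> is at most 1.\<close>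
          have "l w < ennreal b"
          proof -
            have "l w \<noteq> 0" "l w < \<infinity>" using False w unfolding n_def by (auto simp: ennreal_mult_eq_top_iff top.not_eq_extremum)
            then have "l w < 2 * l w" unfolding mult_2 by (cases "l w") (auto simp flip: ennreal_plus simp: ennreal_less_iff less_le)
            then show ?thesis using b n_def by simp
          qed
          then have "(\<integral>\<^sup>+m. \<Phi> (a w m / n w) \<partial>count_space UNIV) \<le> 1" unfolding b l_def by (rule luxemburg_lessD)
          then have "(\<integral>\<^sup>+m. \<Phi> (a w m / n w) \<partial>count_space UNIV) * n w \<le> 1 * n w" by (rule mult_right_mono) simp
          then show ?thesis by (simp add: nn_integral_multc)
        qed simp
      qed
      also have "\<dots> = 1" using r unfolding N_def[symmetric] by simp
      finally have "luxemburg_norm \<Phi> (count_space UNIV) A \<le> ennreal (2 * r)"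
        using r unfolding t_def by (intro luxemburg_leI) (auto simp: ennreal_mult)
      then show ?thesis using r by (simp add: ennreal_mult)
    qed
  qed
  then show ?thesis using N4 unfolding A_def[abs_def] l_def[abs_def] by simp
qed

text \<open>Young's inequality for convolutions: Minkowski's inequality for the counting measure
  over \<open>j\<close>, where each reindexing \<open>p j\<close> preserves the norm.\<close>

lemma luxemburg_convolution_le:
  fixes s :: "'m::countable \<Rightarrow> ennreal" and p :: "'j \<Rightarrow> 'm \<Rightarrow> 'm"
  assumes "\<And>j. bij (p j)" and "\<And>j. c j \<ge> 0"
  shows "luxemburg_norm \<Phi> (count_space UNIV) (\<lambda>m. \<integral>\<^sup>+j. ennreal (c j) * s (p j m) \<partial>count_space UNIV)
    \<le> 4 * (\<integral>\<^sup>+j. ennreal (c j) \<partial>count_space UNIV) * luxemburg_norm \<Phi> (count_space UNIV) s"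
proof -
  have "luxemburg_norm \<Phi> (count_space UNIV) (\<lambda>m. \<integral>\<^sup>+j. ennreal (c j) * s (p j m) \<partial>count_space UNIV)
    \<le> 4 * (\<integral>\<^sup>+j. luxemburg_norm \<Phi> (count_space UNIV) (\<lambda>m. ennreal (c j) * s (p j m)) \<partial>count_space UNIV)"
    by (rule luxemburg_minkowski) simp
  also have "\<dots> \<le> 4 * (\<integral>\<^sup>+j. ennreal (c j) * luxemburg_norm \<Phi> (count_space UNIV) s \<partial>count_space UNIV)"
  proof (intro mult_left_mono nn_integral_mono)
    fix j
    show "luxemburg_norm \<Phi> (count_space UNIV) (\<lambda>m. ennreal (c j) * s (p j m)) \<le> ennreal (c j) * luxemburg_norm \<Phi> (count_space UNIV) s"
      using luxemburg_cmult_le[OF assms(2)[of j], of "count_space UNIV" "\<lambda>m. s (p j m)"]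
      by (simp only: luxemburg_bij[OF assms(1)])
  qed simp
  also have "\<dots> = 4 * (\<integral>\<^sup>+j. ennreal (c j) \<partial>count_space UNIV) * luxemburg_norm \<Phi> (count_space UNIV) s"
    by (simp add: nn_integral_multc mult.assoc)
  finally show ?thesis .
qed

end

text \<open>Minkowski's inequality takes the inner norm under the torus integral, and the outer
  Orlicz space embeds into L^1; \<open>8 * t0\<close> is 4 times \<open>2 * t0\<close>. The mass of
  the torus is a hypothesis because it is computed only further below.\<close>

lemma luxemburg_integral_le_mixed_norm:
  assumes "orlicz_gauge \<Phi>\<^sub>1" "orlicz_gauge \<Phi>\<^sub>2" and tor: "emeasure torus (space (torus :: (real ^ 'n::finite) measure)) \<le> 1"
  obtains C :: real where "C > 0"
    "\<And>F :: (int ^ 'n) \<times> (real ^ 'n) \<Rightarrow> complex. F \<in> borel_measurable (count_space UNIV \<Otimes>\<^sub>M torus) \<Longrightarrow>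
       luxemburg_norm \<Phi>\<^sub>1 (count_space UNIV) (\<lambda>m. \<integral>\<^sup>+w. ennreal (cmod (F (m, w))) \<partial>torus)
         \<le> ennreal C * mixed_norm \<Phi>\<^sub>1 \<Phi>\<^sub>2 F"
proof -
  interpret G1: orlicz_gauge \<Phi>\<^sub>1 by fact
  interpret G2: orlicz_gauge \<Phi>\<^sub>2 by fact
  obtain t0 :: real where t0: "t0 > 0" "1 \<le> \<Phi>\<^sub>2 (ennreal t0)" using G2.large by auto
  show thesis
  proof (rule that[of "8 * t0"])
    fix F :: "(int ^ 'n) \<times> (real ^ 'n) \<Rightarrow> complex"
    assume [measurable]: "F \<in> borel_measurable (count_space UNIV \<Otimes>\<^sub>M torus)"
    have m: "(\<lambda>w. ennreal (cmod (F (m, w)))) \<in> borel_measurable torus" for m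
      by measurable
    let ?n = "\<lambda>w. luxemburg_norm \<Phi>\<^sub>1 (count_space UNIV) (\<lambda>m. ennreal (cmod (F (m, w))))"
    have "luxemburg_norm \<Phi>\<^sub>1 (count_space UNIV) (\<lambda>m. \<integral>\<^sup>+w. ennreal (cmod (F (m, w))) \<partial>torus)
        \<le> 4 * (\<integral>\<^sup>+w. ?n w \<partial>torus)"
      using m by (rule G1.luxemburg_minkowski)
    also have "\<dots> \<le> 4 * (ennreal (2 * t0) * luxemburg_norm \<Phi>\<^sub>2 torus ?n)"
      using G1.luxemburg_measurable[OF m] by (intro mult_left_mono G2.nn_integral_le_luxemburg[OF t0 tor]) auto
    also have "\<dots> = ennreal (8 * t0) * mixed_norm \<Phi>\<^sub>1 \<Phi>\<^sub>2 F"
    proof -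
      have "4 * ennreal (2 * t0) = ennreal (8 * t0)"
        using t0 ennreal_mult[of 4 "2 * t0"] by simp
      then show ?thesis unfolding mixed_norm_def by (simp add: mult.assoc[symmetric])
    qed
    finally show "luxemburg_norm \<Phi>\<^sub>1 (count_space UNIV) (\<lambda>m. \<integral>\<^sup>+w. ennreal (cmod (F (m, w))) \<partial>torus)
         \<le> ennreal (8 * t0) * mixed_norm \<Phi>\<^sub>1 \<Phi>\<^sub>2 F" .
  qed (use t0 in simp)
qed

section \<open>Young functions and their complements as gauges, Hoelder's inequality\<close>

text \<open>Continuity at 0 supplies the field \<open>small\<close> of a gauge: it rules out a jump
  immediately to the right of 0.\<close>

lemma continuous_ennreal_small:
  fixes \<Phi> :: "ennreal \<Rightarrow> ennreal"
  assumes "continuous_on UNIV \<Phi>" "\<Phi> 0 = 0"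
  shows "\<exists>t::real. t > 0 \<and> \<Phi> (ennreal t) \<le> 1"
proof -
  have "((\<lambda>t::real. \<Phi> (ennreal t)) \<longlongrightarrow> \<Phi> (ennreal 0)) (at_right 0)"
  proof (rule isCont_tendsto_compose[of _ \<Phi>])
    show "isCont \<Phi> (ennreal 0)" using assms by (simp add: continuous_on_eq_continuous_at)
    show "(ennreal \<longlongrightarrow> ennreal 0) (at_right 0)" by (intro tendsto_ennrealI tendsto_ident_at)
  qed
  then have "eventually (\<lambda>t::real. \<Phi> (ennreal t) < 1) (at_right 0)"
    using assms by (intro order_tendstoD) auto
  then have "eventually (\<lambda>t::real. \<Phi> (ennreal t) < 1 \<and> t > 0) (at_right 0)"
    using eventually_at_right_less by (rule eventually_conj)
  then show ?thesis
    using eventually_happens[of _ "at_right (0::real)"] trivial_limit_at_right_real by (force intro: less_imp_le)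
qed

text \<open>Star-shapedness is convexity with 0 as the second point; the limit at infinity gives
  \<open>large\<close>.\<close>

lemma young_function_gauge:
  assumes "young_function \<Phi>" "continuous_on UNIV \<Phi>"
  shows "orlicz_gauge \<Phi>"
proof
  show "\<Phi> \<infinity> = \<infinity>" using assms unfolding young_function_def by auto
  show "\<Phi> (u * x) \<le> u * \<Phi> x" if "u \<le> 1" for u x
  proof -
    have "u + (1 - u) = 1" using that by (rule add_diff_inverse_ennreal)
    then have "\<Phi> (u * x + (1 - u) * 0) \<le> u * \<Phi> x + (1 - u) * \<Phi> 0"
      using assms unfolding young_function_def by blast
    then show ?thesis using assms unfolding young_function_def by simp
  qed
  have "((\<lambda>t::real. \<Phi> (ennreal t)) \<longlongrightarrow> \<infinity>) at_top" using assms unfolding young_function_def by auto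
  then have "eventually (\<lambda>t::real. 1 < \<Phi> (ennreal t)) at_top" by (rule order_tendstoD) simp
  then have "eventually (\<lambda>t::real. 1 < \<Phi> (ennreal t) \<and> t > 0) at_top"
    using eventually_gt_at_top by (rule eventually_conj)
  then show "\<exists>t::real. t > 0 \<and> 1 \<le> \<Phi> (ennreal t)"
    using eventually_happens[of _ "at_top :: real filter"] by (force intro: less_imp_le)
  show "\<exists>t::real. t > 0 \<and> \<Phi> (ennreal t) \<le> 1"
    using continuous_ennreal_small[of \<Phi>] assms unfolding young_function_def by auto
  show "\<Phi> \<in> borel_measurable borel" using assms by (intro borel_measurable_continuous_onI)
qed

text \<open>Young's inequality; \<open>x\<close> is finite because the supremum in
  \<open>complementary\<close> ranges over finite arguments, while \<open>y\<close> may be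
  infinite.\<close>

lemma complementary_young:
  assumes "x < \<infinity>"
  shows "x * y \<le> \<Phi> x + complementary \<Phi> y"
proof -
  have "x * y - \<Phi> x \<le> complementary \<Phi> y" unfolding complementary_def using assms by (intro SUP_upper) auto
  then show ?thesis by (simp add: ennreal_minus_le_iff)
qed

text \<open>Scaling Young's inequality by \<open>u \<le> 1\<close> and enlarging
  \<open>u * \<Phi> x\<close> to \<open>\<Phi> x\<close> bounds every term of the supremum, which is
  star-shapedness. Growth comes from testing at one point \<open>s\<close> with
  \<open>\<Phi> (ennreal s) \<le> 1\<close>.\<close>

lemma complementary_gauge:
  assumes "orlicz_gauge \<Phi>" "continuous_on UNIV (complementary \<Phi>)"
  shows "orlicz_gauge (complementary \<Phi>)"
proof
  interpret orlicz_gauge \<Phi> by fact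
  obtain s :: real where s: "s > 0" "\<Phi> (ennreal s) \<le> 1" using small by auto
  have "ennreal s * \<infinity> \<le> \<Phi> (ennreal s) + complementary \<Phi> \<infinity>" by (rule complementary_young) simp
  then show c_top: "complementary \<Phi> \<infinity> = \<infinity>" using s by (auto simp: ennreal_mult_top top_unique)
  show "complementary \<Phi> (u * y) \<le> u * complementary \<Phi> y" if "u \<le> 1" for u y
    unfolding complementary_def[of \<Phi> "u * y"]
  proof (rule SUP_least, safe)
    fix x :: ennreal assume x: "x < \<infinity>"
    have "x * (u * y) \<le> u * (\<Phi> x + complementary \<Phi> y)"
      using mult_left_mono[OF complementary_young[OF x, of y \<Phi>], of u] by (simp add: ac_simps)
    also have "\<dots> = u * \<Phi> x + u * complementary \<Phi> y" by (simp add: distrib_left)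
    also have "\<dots> \<le> \<Phi> x + u * complementary \<Phi> y"
      using mult_right_mono[OF that, of "\<Phi> x"] by (intro add_right_mono) auto
    finally have le: "x * (u * y) \<le> \<Phi> x + u * complementary \<Phi> y" .
    show "x * (u * y) - \<Phi> x \<le> u * complementary \<Phi> y"
    proof (cases "x * (u * y) = \<infinity>")
      case False
      with le show ?thesis by (simp add: ennreal_minus_le_iff)
    next
      \<comment> \<open>As \<open>\<infinity> - \<infinity>\<close> is infinite, \<open>le\<close>
        does not suffice here; the right-hand side itself must be infinite.\<close>
      case True
      with x have u: "u > 0" "y = \<infinity>" using that
        by (auto simp: ennreal_mult_eq_top_iff top_unique zero_less_iff_neq_zero)
      then show ?thesis using u c_top by (simp add: ennreal_mult_top)
    qed
  qed
  \<comment> \<open>The argument \<open>2 / s\<close> makes the product with \<open>s\<close> equal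
    to 2, one more than the bound on \<open>\<Phi> (ennreal s)\<close>.\<close>
  have "2 \<le> 1 + complementary \<Phi> (ennreal (2 / s))"
  proof -
    have "2 = ennreal s * ennreal (2 / s)" using s by (simp add: ennreal_mult[symmetric])
    also have "\<dots> \<le> \<Phi> (ennreal s) + complementary \<Phi> (ennreal (2 / s))" by (rule complementary_young) simp
    also have "\<dots> \<le> 1 + complementary \<Phi> (ennreal (2 / s))" using s by (intro add_right_mono)
    finally show ?thesis .
  qed
  then have "1 \<le> complementary \<Phi> (ennreal (2 / s))"
    unfolding one_add_one[symmetric] ennreal_add_left_cancel_le by auto
  then show "\<exists>t::real. t > 0 \<and> 1 \<le> complementary \<Phi> (ennreal t)" using s by (intro exI[of _ "2 / s"]) auto
  have "complementary \<Phi> 0 = 0" unfolding complementary_def by (intro antisym SUP_least) auto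
  then show "\<exists>t::real. t > 0 \<and> complementary \<Phi> (ennreal t) \<le> 1"
    using continuous_ennreal_small[OF assms(2)] by auto
  show "complementary \<Phi> \<in> borel_measurable borel" using assms by (intro borel_measurable_continuous_onI)
qed

text \<open>Young's inequality is applied to \<open>f m / b\<close> and \<open>h m / c\<close> for
  admissible radii and summed; \<open>f m\<close> must be finite for that. Later arguments use only
  integrability, so the bound \<open>2 * b * c\<close> is not recorded.\<close>

lemma luxemburg_holder:
  fixes f h :: "'m \<Rightarrow> ennreal"
  assumes "orlicz_gauge \<Phi>" "orlicz_gauge (complementary \<Phi>)" "\<And>m. f m < \<infinity>"
    and "luxemburg_norm \<Phi> (count_space UNIV) f < \<infinity>"
    and "luxemburg_norm (complementary \<Phi>) (count_space UNIV) h < \<infinity>"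
  shows "(\<integral>\<^sup>+m. f m * h m \<partial>count_space UNIV) < \<infinity>"
proof -
  interpret F: orlicz_gauge \<Phi> by fact
  interpret H: orlicz_gauge "complementary \<Phi>" by fact
  obtain b where b: "b > 0" "(\<integral>\<^sup>+m. \<Phi> (f m / ennreal b) \<partial>count_space UNIV) \<le> 1"
    using assms(4) unfolding luxemburg_norm_def Inf_less_iff by auto
  obtain c where c: "c > 0" "(\<integral>\<^sup>+m. complementary \<Phi> (h m / ennreal c) \<partial>count_space UNIV) \<le> 1"
    using assms(5) unfolding luxemburg_norm_def Inf_less_iff by auto
  have "f m * h m \<le> ennreal (b * c) * (\<Phi> (f m / ennreal b) + complementary \<Phi> (h m / ennreal c))" for m
  proof -
    have "f m / ennreal b < \<infinity>"
      using assms(3)[of m] b by (simp add: ennreal_divide_eq_top_iff top.not_eq_extremum[symmetric])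
    then have "f m / ennreal b * (h m / ennreal c) \<le> \<Phi> (f m / ennreal b) + complementary \<Phi> (h m / ennreal c)"
      by (rule complementary_young)
    then have "ennreal (b * c) * (f m / ennreal b * (h m / ennreal c))
        \<le> ennreal (b * c) * (\<Phi> (f m / ennreal b) + complementary \<Phi> (h m / ennreal c))"
      by (rule mult_left_mono) simp
    moreover have "ennreal (b * c) * (f m / ennreal b * (h m / ennreal c))
        = (f m / ennreal b * ennreal b) * (h m / ennreal c * ennreal c)"
      using b c by (simp add: ennreal_mult ac_simps)
    moreover have "(f m / ennreal b * ennreal b) * (h m / ennreal c * ennreal c) = f m * h m"
      using b c by (simp add: ennreal_divide_times ennreal_divide_self)
    ultimately show ?thesis by simp
  qed
  then have "(\<integral>\<^sup>+m. f m * h m \<partial>count_space UNIV)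
      \<le> (\<integral>\<^sup>+m. ennreal (b * c) * (\<Phi> (f m / ennreal b) + complementary \<Phi> (h m / ennreal c)) \<partial>count_space UNIV)"
    by (rule nn_integral_mono)
  also have "\<dots> = ennreal (b * c) * ((\<integral>\<^sup>+m. \<Phi> (f m / ennreal b) \<partial>count_space UNIV)
      + (\<integral>\<^sup>+m. complementary \<Phi> (h m / ennreal c) \<partial>count_space UNIV))"
    by (simp add: nn_integral_cmult nn_integral_add)
  also have "\<dots> \<le> ennreal (b * c) * (1 + 1)" using b c by (intro mult_left_mono add_mono) auto
  also have "\<dots> < \<infinity>" by (simp add: ennreal_mult_less_top)
  finally show ?thesis .
qed

section \<open>Fourier analysis on the torus\<close>

text \<open>For complex terms unconditional and absolute convergence agree. The sums of the
  definitions thus become Bochner integrals over the counting measure, to which Fubini's theorem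
  applies.\<close>

lemma integrable_count_iff_summable:
  fixes f :: "'a \<Rightarrow> complex"
  shows "integrable (count_space UNIV) f \<longleftrightarrow> f summable_on UNIV"
  using abs_summable_equivalent[of f UNIV] summable_on_iff_abs_summable_on_complex[of f UNIV]
  unfolding Infinite_Set_Sum.abs_summable_on_def by simp

lemma infsum_eq_integral:
  fixes f :: "'a \<Rightarrow> complex"
  assumes "integrable (count_space UNIV) f"
  shows "infsum f UNIV = (\<integral>k. f k \<partial>count_space UNIV)"
  using infsetsum_infsum[of f UNIV] assms
  unfolding Infinite_Set_Sum.abs_summable_on_def infsetsum_def by simp

lemma integral_count_space_delta:
  fixes f :: "'a \<Rightarrow> complex"
  shows "(\<integral>k. (if k = l then f k else 0) \<partial>count_space UNIV) = f l"
  by (subst lebesgue_integral_count_space_finite_support) (auto simp: Collect_conv_if)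

lemma integrable_bij_count_space:
  fixes f :: "'a \<Rightarrow> 'b :: {banach, second_countable_topology}"
  assumes "bij p"
  shows "integrable (count_space UNIV) (\<lambda>x. f (p x)) \<longleftrightarrow> integrable (count_space UNIV) f"
  using abs_summable_on_reindex_bij_betw[OF assms, of f]
  unfolding Infinite_Set_Sum.abs_summable_on_def .

text \<open>The factor \<open>u\<close> stands for a character or its conjugate, so
  \<open>cmod (c k) * cmod (F w)\<close> dominates the double integrand.\<close>

lemma fubini_count_space:
  fixes u :: "'a::countable \<Rightarrow> 'w \<Rightarrow> complex"
  assumes "sigma_finite_measure M" and F: "integrable M F" and c: "integrable (count_space UNIV) c"
    and u[measurable]: "\<And>k. u k \<in> borel_measurable M" and u1: "\<And>k w. cmod (u k w) \<le> 1"
  shows "(\<integral>w. F w * (\<integral>k. c k * u k w \<partial>count_space UNIV) \<partial>M)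
        = (\<integral>k. c k * (\<integral>w. F w * u k w \<partial>M) \<partial>count_space UNIV)"
proof -
  have [measurable]: "F \<in> borel_measurable M" using F by simp
  have inner: "integrable M (\<lambda>w. F w * u k w)" for k
    by (rule Bochner_Integration.integrable_bound[OF F]) (auto simp: norm_mult mult_left_le u1)
  interpret sigma_finite_measure M by fact
  interpret C: sigma_finite_measure "count_space (UNIV :: 'a set)" by (rule sigma_finite_measure_count_space)
  interpret P: pair_sigma_finite "count_space (UNIV :: 'a set)" M by standard
  have int: "integrable (count_space UNIV \<Otimes>\<^sub>M M) (\<lambda>(k, w). c k * (F w * u k w))"
  proof (rule P.Fubini_integrable)
    show "(\<lambda>(k, w). c k * (F w * u k w)) \<in> borel_measurable (count_space UNIV \<Otimes>\<^sub>M M)"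
      by (rule measurable_pair_measure_countable1) (auto intro: countableI_type)
    show "integrable (count_space UNIV) (\<lambda>k. \<integral>w. norm (case (k, w) of (k, w) \<Rightarrow> c k * (F w * u k w)) \<partial>M)"
    proof (rule Bochner_Integration.integrable_bound)
      show "integrable (count_space UNIV) (\<lambda>k. norm (c k) * (\<integral>w. norm (F w) \<partial>M))" using c by simp
      show "AE k in count_space UNIV. norm (\<integral>w. norm (case (k, w) of (k, w) \<Rightarrow> c k * (F w * u k w)) \<partial>M)
          \<le> norm (norm (c k) * (\<integral>w. norm (F w) \<partial>M))"
      proof (rule AE_I2)
        fix k
        have "(\<integral>w. norm (F w * u k w) \<partial>M) \<le> (\<integral>w. norm (F w) \<partial>M)"
          using integrable_norm[OF inner[of k]] integrable_norm[OF F]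
          by (intro integral_mono) (auto simp: norm_mult mult_left_le u1)
        then show "norm (\<integral>w. norm (case (k, w) of (k, w) \<Rightarrow> c k * (F w * u k w)) \<partial>M)
          \<le> norm (norm (c k) * (\<integral>w. norm (F w) \<partial>M))"
          by (simp add: norm_mult[of "c k"] mult_left_mono)
      qed
    qed simp
    show "AE k in count_space UNIV. integrable M (\<lambda>w. case (k, w) of (k, w) \<Rightarrow> c k * (F w * u k w))"
      using inner by simp
  qed
  have "(\<integral>w. F w * (\<integral>k. c k * u k w \<partial>count_space UNIV) \<partial>M) = (\<integral>w. (\<integral>k. c k * (F w * u k w) \<partial>count_space UNIV) \<partial>M)"
  proof (rule Bochner_Integration.integral_cong)
    fix w
    have "(\<lambda>k. c k * (F w * u k w)) = (\<lambda>k. F w * (c k * u k w))" by (simp add: ac_simps)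
    then show "F w * (\<integral>k. c k * u k w \<partial>count_space UNIV) = (\<integral>k. c k * (F w * u k w) \<partial>count_space UNIV)"
      by simp
  qed simp
  also have "\<dots> = (\<integral>k. (\<integral>w. c k * (F w * u k w) \<partial>M) \<partial>count_space UNIV)"
    by (rule P.Fubini_integral[OF int])
  finally show "(\<integral>w. F w * (\<integral>k. c k * u k w \<partial>count_space UNIV) \<partial>M)
        = (\<integral>k. c k * (\<integral>w. F w * u k w \<partial>M) \<partial>count_space UNIV)" by simp
qed

section \<open>Characters of the torus and their orthogonality\<close>

definition character :: "real ^ 'n::finite \<Rightarrow> int ^ 'n \<Rightarrow> complex" where
  "character w k = cis (2 * pi * (w \<bullet> real_vec k))"

lemma norm_character[simp]: "cmod (character w k) = 1"
  by (simp add: character_def)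

lemma cis_sum: "finite I \<Longrightarrow> cis (\<Sum>i\<in>I. f i) = (\<Prod>i\<in>I. cis (f i))"
  by (induction I rule: finite_induct) (auto simp: cis_mult[symmetric])

lemma character_mult_cnj: "character w k * cnj (character w l) = character w (k - l)"
proof -
  have "real_vec (k - l) = real_vec k - real_vec l" by (simp add: real_vec_def vec_eq_iff)
  then show ?thesis by (simp add: character_def cis_cnj cis_mult inner_diff_right right_diff_distrib)
qed

lemma torus_cube_eq:
  "{w :: real ^ 'n::finite. \<forall>i. 0 \<le> w $ i \<and> w $ i < 1} = {w. \<forall>b\<in>Basis. w \<bullet> b \<in> {0..<1}}"
  by (auto simp: Basis_vec_def cart_eq_inner_axis)

lemma torus_cube_sets[measurable]: "{w :: real ^ 'n::finite. \<forall>i. 0 \<le> w $ i \<and> w $ i < 1} \<in> sets borel"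
  unfolding torus_cube_eq by measurable

lemma character_measurable[measurable]: "(\<lambda>w. character w k) \<in> borel_measurable (torus :: (real ^ 'n::finite) measure)"
  unfolding torus_def character_def cis_conv_exp by (rule measurable_restrict_space1) measurable

lemma emeasure_torus_le: "emeasure torus (space (torus :: (real ^ 'n::finite) measure)) \<le> 1"
proof -
  let ?Q = "{w :: real ^ 'n. \<forall>i. 0 \<le> w $ i \<and> w $ i < 1}"
  have "emeasure torus (space (torus :: (real ^ 'n) measure)) = emeasure lborel ?Q"
    unfolding torus_def by (subst emeasure_restrict_space) (auto simp: space_restrict_space)
  also have "\<dots> \<le> emeasure lborel (cbox 0 One :: (real ^ 'n) set)"
    unfolding torus_cube_eq by (intro emeasure_mono) (force simp: mem_box intro: less_imp_le)+
  also have "\<dots> = 1" by (subst emeasure_lborel_cbox) auto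
  finally show ?thesis .
qed

lemma torus_finite_measure: "finite_measure (torus :: (real ^ 'n::finite) measure)"
proof
  have "emeasure torus (space (torus :: (real ^ 'n::finite) measure)) < \<infinity>"
    using emeasure_torus_le by (rule le_less_trans) simp
  then show "emeasure torus (space (torus :: (real ^ 'n::finite) measure)) \<noteq> \<infinity>" by simp
qed

lemma torus_sigma_finite: "sigma_finite_measure (torus :: (real ^ 'n::finite) measure)"
  using torus_finite_measure unfolding finite_measure_def by blast

text \<open>For \<open>m \<noteq> 0\<close> the primitive \<open>cis (a * t) / (\<i> * a)\<close>
  with \<open>a = 2 * pi * m\<close> takes equal values at 0 and 1. The fundamental theorem works on
  the closed interval, which differs from the half-open one by the null set
  \<open>{1}\<close>.\<close>

lemma integral_cis_unit_interval:
  fixes m :: int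
  shows "has_bochner_integral lborel (\<lambda>t. indicator {0..<1} t *\<^sub>R cis (2 * pi * (t * m))) (if m = 0 then 1 else 0 :: complex)"
proof -
  let ?f = "\<lambda>t::real. cis (2 * pi * (t * m))"
  have cont: "continuous_on {0..1} ?f" by (intro continuous_intros)
  have "has_bochner_integral lborel (\<lambda>t. indicator {0..1} t *\<^sub>R ?f t) (if m = 0 then 1 else 0)"
  proof (cases "m = 0")
    case True
    have "has_bochner_integral lborel (\<lambda>t. indicator {0..1} t *\<^sub>R ?f t) (complex_of_real 1 - complex_of_real 0)"
      using cont True
      by (intro has_bochner_integral_FTC_Icc[where F = complex_of_real])
        (auto intro!: derivative_eq_intros simp: has_vector_derivative_of_real)
    with True show ?thesis by simp
  next
    case False
    define a where "a = 2 * pi * m"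
    have a: "a \<noteq> 0" using False by (simp add: a_def)
    have "has_bochner_integral lborel (\<lambda>t. indicator {0..1} t *\<^sub>R ?f t) (cis (a * 1) / (\<i> * a) - cis (a * 0) / (\<i> * a))"
    proof (rule has_bochner_integral_FTC_Icc[OF _ _ cont])
      fix t :: real
      have "((\<lambda>t. exp (\<i> * a * t) / (\<i> * a)) has_field_derivative exp (\<i> * a * t)) (at (of_real t))" for t :: real
        using a by (auto intro!: derivative_eq_intros)
      then have "((\<lambda>t::real. exp (\<i> * a * of_real t) / (\<i> * a)) has_vector_derivative exp (\<i> * a * of_real t)) (at t within {0..1})"
        by (rule has_vector_derivative_real_field)
      then show "((\<lambda>t::real. cis (a * t) / (\<i> * a)) has_vector_derivative ?f t) (at t within {0..1})"
        by (simp add: cis_conv_exp a_def mult_ac)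
    qed simp
    moreover have "cis a = 1" unfolding a_def by (rule cis_multiple_2pi) simp
    ultimately show ?thesis using False by simp
  qed
  moreover have [measurable]: "?f \<in> borel_measurable borel" unfolding cis_conv_exp by measurable
  moreover have "AE t in lborel. indicator {0..1} t *\<^sub>R ?f t = indicator {0..<1} t *\<^sub>R ?f t"
    by (rule AE_I[where N = "{1}"]) (auto simp: indicator_def)
  ultimately show ?thesis by (subst (asm) has_bochner_integral_cong_AE) auto
qed

text \<open>Lebesgue measure is the image of a product measure over the basis, and both the
  indicator of the cube and the character factor over the coordinates. A non-zero coordinate of
  \<open>k\<close> makes one factor vanish.\<close>

lemma integral_character_torus:
  fixes k :: "int ^ 'n::finite"
  shows "(\<integral>w. character w k \<partial>torus) = (if k = 0 then 1 else 0)"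
proof -
  let ?Q = "{w :: real ^ 'n. \<forall>i. 0 \<le> w $ i \<and> w $ i < 1}"
  let ?B = "Basis :: (real ^ 'n) set"
  let ?\<phi> = "\<lambda>b t. indicator {0..<1} t *\<^sub>R cis (2 * pi * (t * (real_vec k \<bullet> b)))"
  \<comment> \<open>Basis vectors are coordinate axes, so each one-dimensional frequency is an
    integer.\<close>
  have ints: "\<exists>m::int. real_vec k \<bullet> b = m" if "b \<in> ?B" for b
    using that by (auto simp: Basis_vec_def inner_axis real_vec_def)
  interpret product_sigma_finite "\<lambda>b::real^'n. lborel :: real measure" by standard
  have "(\<integral>w. character w k \<partial>torus) = (\<integral>w. indicator ?Q w *\<^sub>R character w k \<partial>lborel)"
    unfolding torus_def by (subst integral_restrict_space) auto
  also have "\<dots> = (\<integral>f. indicator ?Q (\<Sum>b\<in>?B. f b *\<^sub>R b) *\<^sub>R character (\<Sum>b\<in>?B. f b *\<^sub>R b) k \<partial>(\<Pi>\<^sub>M b\<in>?B. lborel))"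
  proof -
    have "(\<lambda>w. indicator ?Q w *\<^sub>R character w k) \<in> borel_measurable borel"
      unfolding character_def cis_conv_exp by measurable
    then show ?thesis by (subst lborel_eq, subst integral_distr) auto
  qed
  also have "\<dots> = (\<integral>f. (\<Prod>b\<in>?B. ?\<phi> b (f b)) \<partial>(\<Pi>\<^sub>M b\<in>?B. lborel))"
  proof (rule Bochner_Integration.integral_cong)
    fix f :: "real ^ 'n \<Rightarrow> real"
    define w where "w = (\<Sum>b\<in>?B. f b *\<^sub>R b)"
    have wb: "w \<bullet> b = f b" if "b \<in> ?B" for b unfolding w_def using that by (simp add: inner_sum_left_Basis)
    have "character w k = cis (\<Sum>b\<in>?B. 2 * pi * (f b * (real_vec k \<bullet> b)))"
      unfolding character_def by (subst euclidean_inner) (simp add: wb sum_distrib_left)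
    also have "\<dots> = (\<Prod>b\<in>?B. cis (2 * pi * (f b * (real_vec k \<bullet> b))))" by (rule cis_sum) simp
    finally have ch: "character w k = (\<Prod>b\<in>?B. cis (2 * pi * (f b * (real_vec k \<bullet> b))))" .
    have "indicator ?Q w = (\<Prod>b\<in>?B. indicator {0..<1} (f b) :: real)"
    proof (cases "w \<in> ?Q")
      case True
      then have "\<forall>b\<in>?B. f b \<in> {0..<1}" unfolding torus_cube_eq using wb by auto
      then show ?thesis using True by simp
    next
      case False
      then obtain b where "b \<in> ?B" "f b \<notin> {0..<1}" unfolding torus_cube_eq using wb by auto
      then have "(\<Prod>b\<in>?B. indicator {0..<1} (f b) :: real) = 0"
        by (intro prod_zero bexI[of _ b]) (auto simp: indicator_def)
      then show ?thesis using False by simp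
    qed
    then show "indicator ?Q (\<Sum>b\<in>?B. f b *\<^sub>R b) *\<^sub>R character (\<Sum>b\<in>?B. f b *\<^sub>R b) k = (\<Prod>b\<in>?B. ?\<phi> b (f b))"
      unfolding w_def[symmetric] by (simp add: ch scaleR_conv_of_real prod.distrib)
  qed simp
  also have "\<dots> = (\<Prod>b\<in>?B. integral\<^sup>L lborel (?\<phi> b))"
  proof (rule product_integral_prod)
    fix b assume "b \<in> ?B"
    then obtain m :: int where "real_vec k \<bullet> b = m" using ints by blast
    then show "integrable lborel (?\<phi> b)" using integral_cis_unit_interval[of m] by (auto simp: has_bochner_integral_iff)
  qed simp
  also have "\<dots> = (if k = 0 then 1 else 0)"
  proof -
    have val: "integral\<^sup>L lborel (?\<phi> (axis i 1)) = (if k $ i = 0 then 1 else 0)" for i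
    proof -
      have "real_vec k \<bullet> axis i 1 = k $ i" by (simp add: inner_axis real_vec_def)
      then show ?thesis using integral_cis_unit_interval[of "k $ i"] by (auto simp: has_bochner_integral_iff)
    qed
    show ?thesis
    proof (cases "k = 0")
      case True
      have "integral\<^sup>L lborel (?\<phi> b) = 1" if b: "b \<in> ?B" for b
      proof -
        obtain i where "b = axis i 1" using b axis_inverse by blast
        then show ?thesis using val[of i] True by simp
      qed
      then show ?thesis using True by simp
    next
      case False
      then obtain i where "k $ i \<noteq> 0" by (auto simp: vec_eq_iff)
      then have "integral\<^sup>L lborel (?\<phi> (axis i 1)) = 0" using val[of i] by simp
      moreover have "axis i 1 \<in> ?B" by simp
      ultimately have "(\<Prod>b\<in>?B. integral\<^sup>L lborel (?\<phi> b)) = 0"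
        by (intro prod_zero bexI[of _ "axis i 1"]) auto
      then show ?thesis using False by simp
    qed
  qed
  finally show ?thesis .
qed

section \<open>Rapidly decreasing functions and the short-time Fourier transform\<close>

lemma one_le_weight: "1 \<le> 1 + norm (real_vec k)" by simp

lemma weight_pos: "0 < 1 + norm (real_vec k)"
  using one_le_weight by (rule less_le_trans[rotated]) simp

lemma integrable_inverse_square_int: "integrable (count_space UNIV) (\<lambda>j::int. 1 / (1 + real_of_int \<bar>j\<bar>)\<^sup>2)"
proof -
  let ?f = "\<lambda>j::int. 1 / (1 + real_of_int \<bar>j\<bar>)\<^sup>2"
  have nat: "Infinite_Set_Sum.abs_summable_on (\<lambda>n::nat. 1 / (1 + real n)\<^sup>2) UNIV"
  proof -
    have "summable (\<lambda>n. inverse ((real (Suc n))\<^sup>2))"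
      using inverse_power_summable[of 2, where 'a = real] by (subst summable_Suc_iff) simp
    then show ?thesis unfolding abs_summable_on_nat_iff' by (simp add: field_simps)
  qed
  have "Infinite_Set_Sum.abs_summable_on ?f (range int)"
    by (subst abs_summable_on_reindex_iff[symmetric]) (use nat in \<open>auto simp: inj_on_def\<close>)
  moreover have "Infinite_Set_Sum.abs_summable_on ?f (range (\<lambda>n. - int n))"
    by (subst abs_summable_on_reindex_iff[symmetric]) (use nat in \<open>auto simp: inj_on_def\<close>)
  ultimately have "Infinite_Set_Sum.abs_summable_on ?f (range int \<union> range (\<lambda>n. - int n))" by (rule abs_summable_on_union)
  moreover have "range int \<union> range (\<lambda>n. - int n) = UNIV"
  proof (intro equalityI subsetI UNIV_I)
    fix j :: int
    show "j \<in> range int \<union> range (\<lambda>n. - int n)" by (cases j rule: int_cases2) auto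
  qed
  ultimately show ?thesis unfolding Infinite_Set_Sum.abs_summable_on_def by simp
qed

text \<open>The exponent \<open>2 * CARD('n)\<close> provides one square per coordinate; every
  coordinate is at most the norm in modulus, so a product of convergent one-dimensional series
  dominates.\<close>

lemma integrable_weight:
  "integrable (count_space UNIV) (\<lambda>k :: int ^ 'n::finite. 1 / (1 + norm (real_vec k)) ^ (2 * CARD('n)))"
proof -
  let ?P = "\<lambda>k :: int ^ 'n. \<Prod>i\<in>UNIV. 1 / (1 + real_of_int \<bar>k $ i\<bar>)\<^sup>2"
  have "Infinite_Set_Sum.abs_summable_on (\<lambda>x :: 'n \<Rightarrow> int. \<Prod>i\<in>UNIV. 1 / (1 + real_of_int \<bar>x i\<bar>)\<^sup>2) (PiE UNIV (\<lambda>_. UNIV))"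
    using integrable_inverse_square_int
    by (intro abs_summable_on_prod_PiE) (auto simp: Infinite_Set_Sum.abs_summable_on_def)
  then have "integrable (count_space UNIV) (\<lambda>x :: 'n \<Rightarrow> int. ?P (vec_lambda x))"
    by (simp add: Infinite_Set_Sum.abs_summable_on_def PiE_UNIV_domain)
  then have P: "integrable (count_space UNIV) ?P"
    using integrable_bij_count_space[OF o_bij[of vec_nth vec_lambda], of ?P] by (simp add: fun_eq_iff)
  show ?thesis
  proof (rule Bochner_Integration.integrable_bound[OF P], simp, rule AE_I2)
    fix k :: "int ^ 'n"
    have "(\<Prod>i\<in>UNIV. (1 + real_of_int \<bar>k $ i\<bar>)\<^sup>2) \<le> (\<Prod>i\<in>(UNIV :: 'n set). (1 + norm (real_vec k))\<^sup>2)"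
    proof (rule prod_mono, safe)
      fix i
      have "\<bar>real_vec k $ i\<bar> \<le> norm (real_vec k)" by (rule component_le_norm_cart)
      then show "(1 + real_of_int \<bar>k $ i\<bar>)\<^sup>2 \<le> (1 + norm (real_vec k))\<^sup>2"
        by (intro power_mono) (auto simp: real_vec_def)
    qed simp
    also have "\<dots> = (1 + norm (real_vec k)) ^ (2 * CARD('n))" by (simp add: power_mult)
    finally have le: "(\<Prod>i\<in>UNIV. (1 + real_of_int \<bar>k $ i\<bar>)\<^sup>2) \<le> (1 + norm (real_vec k)) ^ (2 * CARD('n))" .
    have "0 < (\<Prod>i\<in>UNIV. (1 + real_of_int \<bar>k $ i\<bar>)\<^sup>2)" by (intro prod_pos) (auto intro!: zero_less_power add_pos_nonneg)
    then have "1 / (1 + norm (real_vec k)) ^ (2 * CARD('n)) \<le> 1 / (\<Prod>i\<in>UNIV. (1 + real_of_int \<bar>k $ i\<bar>)\<^sup>2)"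
      using le by (intro divide_left_mono) (auto intro: mult_pos_pos less_le_trans)
    also have "\<dots> = ?P k" by (simp add: prod_dividef)
    finally show "norm (1 / (1 + norm (real_vec k)) ^ (2 * CARD('n))) \<le> norm (?P k)"
      by (auto intro: order_trans)
  qed
qed

text \<open>The definition permits any real \<open>C\<close>; evaluation at \<open>k = 0\<close>
  shows that it is non-negative.\<close>

lemma schwartz_bound:
  fixes g :: "int ^ 'n::finite \<Rightarrow> complex"
  assumes "g \<in> schwartz"
  obtains C where "C \<ge> 0" "\<And>k. cmod (g k) \<le> C / (1 + norm (real_vec k)) ^ M"
proof -
  obtain C where C: "\<And>k. cmod (g k) \<le> C / (1 + norm (real_vec k)) ^ M"
    using assms unfolding schwartz_def by blast
  have "0 \<le> C / (1 + norm (real_vec (0 :: int ^ 'n))) ^ M" by (rule order_trans[OF norm_ge_zero C])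
  then have "C \<ge> 0" using zero_less_power[OF weight_pos, of "0 :: int ^ 'n" M] by (simp add: zero_le_divide_iff)
  with C show ?thesis using that by blast
qed

lemma schwartz_integrable:
  assumes "g \<in> schwartz"
  shows "integrable (count_space UNIV) (g :: int ^ 'n::finite \<Rightarrow> complex)"
proof -
  obtain C where C: "C \<ge> 0" "\<And>k. cmod (g k) \<le> C / (1 + norm (real_vec k)) ^ (2 * CARD('n))"
    using schwartz_bound[OF assms, where M = "2 * CARD('n)"] by blast
  have "integrable (count_space UNIV) (\<lambda>k :: int ^ 'n. C * (1 / (1 + norm (real_vec k)) ^ (2 * CARD('n))))"
    using integrable_weight by (rule integrable_mult_right)
  then show ?thesis
    by (rule Bochner_Integration.integrable_bound) (use C in \<open>auto simp: abs_of_nonneg\<close>)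
qed

text \<open>Decay of order \<open>j\<close> bounds the range from above, without which a real
  supremum would carry no information.\<close>

lemma schwartz_le_seminorm:
  assumes "g \<in> schwartz"
  shows "(1 + norm (real_vec k)) ^ j * cmod (g k) \<le> schwartz_seminorm j g"
proof -
  obtain C where C: "C \<ge> 0" "\<And>k. cmod (g k) \<le> C / (1 + norm (real_vec k)) ^ j"
    using schwartz_bound[OF assms] by blast
  have "bdd_above (range (\<lambda>k. (1 + norm (real_vec k)) ^ j * cmod (g k)))"
  proof (rule bdd_aboveI2)
    fix k show "(1 + norm (real_vec k)) ^ j * cmod (g k) \<le> C"
      using C(2)[of k] zero_less_power[OF weight_pos, of k j] by (simp add: pos_le_divide_eq mult.commute)
  qed
  then show ?thesis unfolding schwartz_seminorm_def by (intro cSUP_upper) auto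
qed

lemma weight_translation:
  "1 + norm (real_vec k) \<le> (1 + norm (real_vec m)) * (1 + norm (real_vec (k - m)))"
proof -
  have "real_vec k = real_vec m + real_vec (k - m)" by (simp add: real_vec_def vec_eq_iff)
  then have "norm (real_vec k) \<le> norm (real_vec m) + norm (real_vec (k - m))" by (metis norm_triangle_ineq)
  moreover have "0 \<le> norm (real_vec m) * norm (real_vec (k - m))" by simp
  ultimately show ?thesis unfolding distrib_left distrib_right by linarith
qed

text \<open>Submultiplicativity of the weight transfers decay from \<open>k - m\<close> to
  \<open>k\<close>, at the cost of \<open>(1 + norm (real_vec m)) ^ M\<close>.\<close>

lemma schwartz_translation:
  assumes "g \<in> schwartz"
  shows "(\<lambda>k. g (k - m)) \<in> schwartz"
  unfolding schwartz_def
proof (safe)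
  fix M :: nat
  obtain C where C: "C \<ge> 0" "\<And>k. cmod (g k) \<le> C / (1 + norm (real_vec k)) ^ M"
    using schwartz_bound[OF assms] by blast
  have "cmod (g (k - m)) \<le> C * (1 + norm (real_vec m)) ^ M / (1 + norm (real_vec k)) ^ M" for k
  proof -
    have "(1 + norm (real_vec k)) ^ M \<le> (1 + norm (real_vec m)) ^ M * (1 + norm (real_vec (k - m))) ^ M"
      using power_mono[OF weight_translation[of k m], of M] by (simp add: power_mult_distrib)
    then have "C * (1 + norm (real_vec k)) ^ M \<le> C * ((1 + norm (real_vec m)) ^ M * (1 + norm (real_vec (k - m))) ^ M)"
      using C(1) by (rule mult_left_mono)
    then have "C / (1 + norm (real_vec (k - m))) ^ M \<le> C * (1 + norm (real_vec m)) ^ M / (1 + norm (real_vec k)) ^ M"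
      using zero_less_power[OF weight_pos, of k M] zero_less_power[OF weight_pos, of "k - m" M]
      by (simp add: field_simps)
    with C(2)[of "k - m"] show ?thesis by simp
  qed
  then show "\<exists>C. \<forall>k. cmod (g (k - m)) \<le> C / (1 + norm (real_vec k)) ^ M" by blast
qed

lemma tempered_integrable:
  assumes "f \<in> tempered" "g \<in> schwartz"
  shows "integrable (count_space UNIV) (\<lambda>k. f k * cnj (g k))"
  using assms unfolding tempered_def integrable_count_iff_summable by blast

text \<open>The seminorm of order \<open>2 * CARD('n)\<close> witnesses continuity:
  \<open>cmod (g k)\<close> is at most this seminorm times a summable inverse weight.\<close>

lemma bounded_tempered:
  fixes f :: "int ^ 'n::finite \<Rightarrow> complex"
  assumes B: "\<And>k. cmod (f k) \<le> B"
  shows "f \<in> tempered"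
proof -
  have B0: "B \<ge> 0" using B[of undefined] norm_ge_zero order_trans by blast
  have int: "integrable (count_space UNIV) (\<lambda>k. f k * cnj (g k))" if "g \<in> schwartz" for g
  proof (rule Bochner_Integration.integrable_bound)
    show "integrable (count_space UNIV) (\<lambda>k. B * cmod (g k))" using schwartz_integrable[OF that] by simp
  qed (auto simp: norm_mult B0 intro!: mult_right_mono B)
  let ?W = "\<integral>k. 1 / (1 + norm (real_vec (k :: int ^ 'n))) ^ (2 * CARD('n)) \<partial>count_space UNIV"
  have "cmod (lattice_pairing f g) \<le> (B * ?W) * schwartz_seminorm (2 * CARD('n)) g" if g: "g \<in> schwartz" for g
  proof -
    let ?s = "schwartz_seminorm (2 * CARD('n)) g"
    have le: "cmod (f k * cnj (g k)) \<le> (B * ?s) * (1 / (1 + norm (real_vec k)) ^ (2 * CARD('n)))" for k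
    proof -
      have "cmod (g k) \<le> ?s / (1 + norm (real_vec k)) ^ (2 * CARD('n))"
        using schwartz_le_seminorm[OF g, of k "2 * CARD('n)"] zero_less_power[OF weight_pos, of k "2 * CARD('n)"]
        by (simp add: pos_le_divide_eq mult.commute)
      then have "cmod (f k) * cmod (g k) \<le> B * (?s / (1 + norm (real_vec k)) ^ (2 * CARD('n)))"
        using B[of k] B0 by (intro mult_mono) auto
      then show ?thesis by (simp add: norm_mult)
    qed
    have "lattice_pairing f g = (\<integral>k. f k * cnj (g k) \<partial>count_space UNIV)"
      unfolding lattice_pairing_def using int[OF g] by (rule infsum_eq_integral)
    also have "cmod \<dots> \<le> (\<integral>k. cmod (f k * cnj (g k)) \<partial>count_space UNIV)"
      by (rule integral_norm_bound)
    also have "\<dots> \<le> (\<integral>k. (B * ?s) * (1 / (1 + norm (real_vec (k :: int ^ 'n))) ^ (2 * CARD('n))) \<partial>count_space UNIV)"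
      by (rule Bochner_Integration.integral_mono[OF integrable_norm[OF int[OF g]] integrable_mult_right[OF integrable_weight] le])
    also have "\<dots> = (B * ?W) * ?s" by (subst integral_mult_right_zero) simp
    finally show ?thesis .
  qed
  moreover have "\<forall>g\<in>schwartz. (\<lambda>k. f k * cnj (g k)) summable_on UNIV"
    using int unfolding integrable_count_iff_summable by blast
  ultimately show ?thesis unfolding tempered_def by blast
qed

section \<open>The short-time Fourier transform as a Fourier series in the torus variable\<close>

lemma cnj_measurable: "f \<in> borel_measurable M \<Longrightarrow> (\<lambda>x. cnj (f x)) \<in> borel_measurable M"
  by (rule measurable_compose[OF _ borel_measurable_continuous_onI[OF continuous_on_cnj[OF continuous_on_id]]])

lemma cnj_character_measurable[measurable]: "(\<lambda>w. cnj (character w k)) \<in> borel_measurable torus"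
  by (rule cnj_measurable) measurable

text \<open>Conjugation in \<open>lattice_pairing\<close> turns the modulation into
  \<open>cnj (character w k)\<close>: for fixed \<open>m\<close> the transform is a Fourier series
  with coefficients \<open>f k * cnj (g (k - m))\<close>.\<close>

lemma stft_eq_integral:
  assumes "integrable (count_space UNIV) (\<lambda>k. f k * cnj (g (k - m)))"
  shows "stft g f (m, w) = (\<integral>k. f k * cnj (g (k - m)) * cnj (character w k) \<partial>count_space UNIV)"
proof -
  have "integrable (count_space UNIV) (\<lambda>k. f k * cnj (g (k - m)) * cnj (character w k))"
    by (rule Bochner_Integration.integrable_bound[OF assms]) (auto simp: norm_mult)
  moreover have "stft g f (m, w) = (\<Sum>\<^sub>\<infinity>k. f k * cnj (g (k - m)) * cnj (character w k))"
    unfolding stft_def lattice_pairing_def modulation_def translation_def character_def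
    by (simp add: mult_ac)
  ultimately show ?thesis using infsum_eq_integral by metis
qed

lemma tempered_window_integrable:
  assumes "f \<in> tempered" "g \<in> schwartz"
  shows "integrable (count_space UNIV) (\<lambda>k. f k * cnj (g (k - m)))"
  using tempered_integrable[OF assms(1) schwartz_translation[OF assms(2)]] .

text \<open>The lattice factor is countable, so each \<open>m\<close> can be treated separately;
  there the transform is a parameter integral of a jointly measurable function.\<close>

lemma stft_measurable:
  fixes f g :: "int ^ 'n::finite \<Rightarrow> complex"
  assumes "f \<in> tempered" "g \<in> schwartz"
  shows "stft g f \<in> borel_measurable (count_space UNIV \<Otimes>\<^sub>M torus)"
proof (rule measurable_pair_measure_countable1)
  fix m :: "int ^ 'n"
  interpret C: sigma_finite_measure "count_space (UNIV :: (int ^ 'n) set)" by (rule sigma_finite_measure_count_space)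
  have "(\<lambda>(w, k). f k * cnj (g (k - m)) * cnj (character w k)) \<in> borel_measurable (torus \<Otimes>\<^sub>M count_space UNIV)"
    unfolding split_beta
    by (rule measurable_compose_countable'[where f = "\<lambda>k x. f k * cnj (g (k - m)) * cnj (character (fst x) k)" and g = snd and I = UNIV])
      (auto simp: countableI_type intro!: borel_measurable_times measurable_compose[OF measurable_fst cnj_character_measurable])
  then have "(\<lambda>w. \<integral>k. f k * cnj (g (k - m)) * cnj (character w k) \<partial>count_space UNIV) \<in> borel_measurable torus"
    by (rule C.borel_measurable_lebesgue_integral)
  then show "(\<lambda>w. stft g f (m, w)) \<in> borel_measurable torus"
    by (simp add: stft_eq_integral[OF tempered_window_integrable[OF assms]])
qed (rule countableI_type)

lemma character_integrable: "integrable torus (\<lambda>w. character w l)"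
proof -
  interpret finite_measure torus by (rule torus_finite_measure)
  show ?thesis by (rule integrable_const_bound[where B = 1]) auto
qed

text \<open>Orthogonality of characters extracts the coefficient of index \<open>l\<close>; absolute
  summability of \<open>f\<close> against the translated window justifies the interchange.\<close>

lemma stft_inversion:
  assumes "f \<in> tempered" "g \<in> schwartz"
  shows "(\<integral>w. stft g f (m, w) * character w l \<partial>torus) = f l * cnj (g (l - m))"
proof -
  note int = tempered_window_integrable[OF assms]
  have "(\<integral>w. stft g f (m, w) * character w l \<partial>torus)
      = (\<integral>w. character w l * (\<integral>k. f k * cnj (g (k - m)) * cnj (character w k) \<partial>count_space UNIV) \<partial>torus)"
    by (simp add: stft_eq_integral[OF int] mult.commute)
  also have "\<dots> = (\<integral>k. f k * cnj (g (k - m)) * (\<integral>w. character w l * cnj (character w k) \<partial>torus) \<partial>count_space UNIV)"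
    by (rule fubini_count_space[OF torus_sigma_finite character_integrable int cnj_character_measurable]) simp
  also have "\<dots> = (\<integral>k. (if k = l then f k * cnj (g (k - m)) else 0) \<partial>count_space UNIV)"
    by (intro Bochner_Integration.integral_cong) (auto simp: character_mult_cnj integral_character_torus)
  also have "\<dots> = f l * cnj (g (l - m))"
    by (rule integral_count_space_delta)
  finally show ?thesis .
qed

text \<open>Taking moduli removes the characters, so the bound is uniform in \<open>w\<close>; the
  substitution \<open>j = k - m\<close> gives the form required by
  \<open>luxemburg_convolution_le\<close>.\<close>

lemma cmod_stft_le:
  assumes "f \<in> tempered" "g \<in> schwartz"
  shows "ennreal (cmod (stft g f (m, w)))
    \<le> (\<integral>\<^sup>+j. ennreal (cmod (g j)) * ennreal (cmod (f (m + j))) \<partial>count_space UNIV)"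
proof -
  note int = tempered_window_integrable[OF assms, of m]
  have "cmod (stft g f (m, w)) \<le> (\<integral>k. cmod (f k * cnj (g (k - m)) * cnj (character w k)) \<partial>count_space UNIV)"
    unfolding stft_eq_integral[OF int] by (rule integral_norm_bound)
  also have "\<dots> = (\<integral>k. cmod (f k * cnj (g (k - m))) \<partial>count_space UNIV)" by (simp add: norm_mult)
  finally have "ennreal (cmod (stft g f (m, w))) \<le> ennreal (\<integral>k. cmod (f k * cnj (g (k - m))) \<partial>count_space UNIV)"
    by (rule ennreal_leI)
  also have "\<dots> = (\<integral>\<^sup>+k. ennreal (cmod (f k * cnj (g (k - m)))) \<partial>count_space UNIV)"
    using int by (intro nn_integral_eq_integral[symmetric]) auto
  also have "\<dots> = (\<integral>\<^sup>+k. ennreal (cmod (g (k - m))) * ennreal (cmod (f (m + (k - m)))) \<partial>count_space UNIV)"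
    by (simp add: norm_mult ennreal_mult mult.commute)
  also have "\<dots> = (\<integral>\<^sup>+j. ennreal (cmod (g j)) * ennreal (cmod (f (m + j))) \<partial>count_space UNIV)"
    by (rule nn_integral_bij_count_space[where g = "\<lambda>k. k - m" and f = "\<lambda>j. ennreal (cmod (g j)) * ennreal (cmod (f (m + j)))"])
      (rule bij_betw_byWitness[where f' = "\<lambda>k. k + m"], auto)
  finally show ?thesis .
qed

section \<open>Modulation spaces as Orlicz sequence spaces\<close>

abbreviation orlicz_norm :: "(ennreal \<Rightarrow> ennreal) \<Rightarrow> ('m \<Rightarrow> complex) \<Rightarrow> ennreal" where
  "orlicz_norm \<Phi> f \<equiv> luxemburg_norm \<Phi> (count_space UNIV) (\<lambda>m. ennreal (cmod (f m)))"

lemma norm_integral_le_nn_integral: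
  fixes f :: "'a \<Rightarrow> complex"
  shows "ennreal (cmod (\<integral>x. f x \<partial>M)) \<le> (\<integral>\<^sup>+x. ennreal (cmod (f x)) \<partial>M)"
  by (cases "integrable M f") (auto simp: integral_norm_bound_ennreal not_integrable_integral_eq)

lemma nn_integral_cmod_eq:
  assumes "g \<in> schwartz"
  obtains r where "r \<ge> 0" "(\<integral>\<^sup>+j. ennreal (cmod (g j)) \<partial>count_space UNIV) = ennreal r"
  using nn_integral_eq_integral[OF integrable_norm[OF schwartz_integrable[OF assms]]]
  by (intro that[of "\<integral>j. cmod (g j) \<partial>count_space UNIV"]) auto

lemma bij_minus_const: "bij (\<lambda>k :: 'a :: ab_group_add. k - m)"
  by (rule bij_betw_byWitness[where f' = "\<lambda>k. k + m"]) auto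

lemma bij_const_minus: "bij (\<lambda>k :: 'a :: ab_group_add. m - k)"
  by (rule bij_betw_byWitness[where f' = "\<lambda>k. m - k"]) auto

lemma bij_plus_const: "bij (\<lambda>k :: 'a :: ab_group_add. k + m)"
  by (rule bij_betw_byWitness[where f' = "\<lambda>k. k - m"]) auto

context orlicz_gauge
begin

lemma orlicz_norm_add_le:
  fixes f h :: "'m::countable \<Rightarrow> complex"
  shows "orlicz_norm \<Phi> (\<lambda>k. f k + h k) \<le> 4 * (orlicz_norm \<Phi> f + orlicz_norm \<Phi> h)"
proof -
  \<comment> \<open>Minkowski's inequality over a two-point space\<close>
  let ?a = "\<lambda>b m. ennreal (cmod (if b then f m else h m))"
  have "orlicz_norm \<Phi> (\<lambda>k. f k + h k) \<le> luxemburg_norm \<Phi> (count_space UNIV) (\<lambda>m. \<integral>\<^sup>+b. ?a b m \<partial>count_space UNIV)"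
    by (rule luxemburg_mono)
      (auto simp: nn_integral_count_space_finite UNIV_bool norm_triangle_ineq add.commute simp flip: ennreal_plus intro!: ennreal_leI)
  also have "\<dots> \<le> 4 * (\<integral>\<^sup>+b. luxemburg_norm \<Phi> (count_space UNIV) (?a b) \<partial>count_space UNIV)"
    by (rule luxemburg_minkowski) simp
  also have "\<dots> = 4 * (orlicz_norm \<Phi> f + orlicz_norm \<Phi> h)"
    by (simp add: nn_integral_count_space_finite UNIV_bool add.commute)
  finally show ?thesis .
qed

lemma orlicz_norm_cmult_le: "orlicz_norm \<Phi> (\<lambda>k. c * f k) \<le> ennreal (cmod c) * orlicz_norm \<Phi> f"
  using luxemburg_cmult_le[of "cmod c" "count_space UNIV" "\<lambda>m. ennreal (cmod (f m))"] by (simp add: norm_mult ennreal_mult)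

text \<open>These are the test sequences that read off single values in the pairing. A
  \<open>t\<close> with \<open>\<Phi> (ennreal t) \<le> 1\<close> makes the radius
  \<open>1 / t\<close> admissible.\<close>

lemma orlicz_norm_delta: "orlicz_norm \<Phi> (\<lambda>k. if k = l then 1 else 0) < \<infinity>"
proof -
  obtain t :: real where t: "t > 0" "\<Phi> (ennreal t) \<le> 1" using small by auto
  have "\<Phi> (ennreal (cmod (if k = l then 1 else 0)) / ennreal (1 / t)) = \<Phi> (ennreal t) * indicator {l} k" for k
    using t divide_ennreal[of 1 "1 / t"] by (auto simp: zero indicator_def)
  then have "(\<integral>\<^sup>+k. \<Phi> (ennreal (cmod (if k = l then 1 else 0)) / ennreal (1 / t)) \<partial>count_space UNIV) \<le> 1"
    using t by (simp add: nn_integral_cmult_indicator)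
  then have "orlicz_norm \<Phi> (\<lambda>k. if k = l then 1 else 0) \<le> ennreal (1 / t)" using t by (intro luxemburg_leI) auto
  then show ?thesis by (rule le_less_trans) simp
qed

text \<open>Orlicz sequences are bounded by \<open>le_luxemburg\<close>, and bounded sequences are
  tempered.\<close>

lemma orlicz_norm_finite_tempered:
  assumes "orlicz_norm \<Phi> (f :: int ^ 'n::finite \<Rightarrow> complex) < \<infinity>"
  shows "f \<in> tempered"
proof -
  obtain t :: real where t: "t > 0" "1 \<le> \<Phi> (ennreal t)" using large by auto
  obtain r where r: "orlicz_norm \<Phi> f = ennreal r" "r \<ge> 0" using assms by (cases "orlicz_norm \<Phi> f") auto
  have "cmod (f k) \<le> t * r" for k
  proof -
    have "ennreal (cmod (f k)) \<le> ennreal t * ennreal r"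
      using le_luxemburg[OF t, of "\<lambda>m. ennreal (cmod (f m))" k] r by simp
    then show ?thesis using t r by (simp add: ennreal_mult[symmetric])
  qed
  then show ?thesis by (rule bounded_tempered)
qed

end

section \<open>Equivalence of the modulation norm and the Orlicz sequence norm\<close>

text \<open>The convolution bound has the same constant for every \<open>w\<close>, so the outer
  norm is compared with that of a constant function. The summand 1 in \<open>4 * r / t + 1\<close>
  keeps the constant positive for a zero window.\<close>

lemma mixed_norm_stft_le:
  fixes g :: "int ^ 'n::finite \<Rightarrow> complex"
  assumes "orlicz_gauge \<Phi>\<^sub>1" "orlicz_gauge \<Phi>\<^sub>2" and g: "g \<in> schwartz"
  obtains C :: real where "C > 0"
    "\<And>f. orlicz_norm \<Phi>\<^sub>1 f < \<infinity> \<Longrightarrow> mixed_norm \<Phi>\<^sub>1 \<Phi>\<^sub>2 (stft g f) \<le> ennreal C * orlicz_norm \<Phi>\<^sub>1 f"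
proof -
  interpret G1: orlicz_gauge \<Phi>\<^sub>1 by fact
  interpret G2: orlicz_gauge \<Phi>\<^sub>2 by fact
  obtain t :: real where t: "t > 0" "\<Phi>\<^sub>2 (ennreal t) \<le> 1" using G2.small by auto
  obtain r where r: "r \<ge> 0" "(\<integral>\<^sup>+j. ennreal (cmod (g j)) \<partial>count_space UNIV) = ennreal r"
    using nn_integral_cmod_eq[OF g] .
  have C: "ennreal (1 / t) * (4 * ennreal r * x) \<le> ennreal (4 * r / t + 1) * x" for x
  proof -
    have "ennreal (1 / t) * (4 * ennreal r) = ennreal (4 * r / t)"
      using t r ennreal_mult[of "1 / t" "4 * r"] ennreal_mult[of 4 r] by simp
    then have "ennreal (1 / t) * (4 * ennreal r * x) = ennreal (4 * r / t) * x" by (simp add: mult.assoc[symmetric])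
    also have "\<dots> \<le> ennreal (4 * r / t + 1) * x" by (intro mult_right_mono ennreal_leI) auto
    finally show ?thesis .
  qed
  show thesis
  proof (rule that[of "4 * r / t + 1"])
    show "4 * r / t + 1 > 0" using t r by (intro add_nonneg_pos) auto
    fix f :: "int ^ 'n \<Rightarrow> complex" assume f: "orlicz_norm \<Phi>\<^sub>1 f < \<infinity>"
    note ft = G1.orlicz_norm_finite_tempered[OF f]
    have "luxemburg_norm \<Phi>\<^sub>1 (count_space UNIV) (\<lambda>m. ennreal (cmod (stft g f (m, w)))) \<le> 4 * ennreal r * orlicz_norm \<Phi>\<^sub>1 f" for w
    proof -
      have "luxemburg_norm \<Phi>\<^sub>1 (count_space UNIV) (\<lambda>m. ennreal (cmod (stft g f (m, w))))
          \<le> luxemburg_norm \<Phi>\<^sub>1 (count_space UNIV) (\<lambda>m. \<integral>\<^sup>+j. ennreal (cmod (g j)) * ennreal (cmod (f (m + j))) \<partial>count_space UNIV)"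
        using cmod_stft_le[OF ft g] by (intro G1.luxemburg_mono)
      also have "\<dots> \<le> 4 * ennreal r * orlicz_norm \<Phi>\<^sub>1 f"
        using G1.luxemburg_convolution_le[of "\<lambda>j m. m + j" "\<lambda>j. cmod (g j)" "\<lambda>m. ennreal (cmod (f m))",
            OF bij_plus_const norm_ge_zero] unfolding r .
      finally show ?thesis .
    qed
    then have "mixed_norm \<Phi>\<^sub>1 \<Phi>\<^sub>2 (stft g f) \<le> ennreal (1 / t) * (4 * ennreal r * orlicz_norm \<Phi>\<^sub>1 f)"
      unfolding mixed_norm_def by (intro G2.luxemburg_const_le[OF t emeasure_torus_le])
    also note C
    finally show "mixed_norm \<Phi>\<^sub>1 \<Phi>\<^sub>2 (stft g f) \<le> ennreal (4 * r / t + 1) * orlicz_norm \<Phi>\<^sub>1 f" .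
  qed
qed

text \<open>Inversion at \<open>m = k - j\<close>, for a fixed \<open>j\<close> with
  \<open>g j \<noteq> 0\<close>, isolates \<open>f k\<close> up to the factor
  \<open>cnj (g j)\<close>; hence \<open>1 / cmod (g j)\<close> in the constant. The shift by
  \<open>j\<close> preserves the norm.\<close>

lemma orlicz_norm_le_mixed_norm_stft:
  fixes g :: "int ^ 'n::finite \<Rightarrow> complex"
  assumes "orlicz_gauge \<Phi>\<^sub>1" "orlicz_gauge \<Phi>\<^sub>2" and g: "g \<in> schwartz" "g \<noteq> (\<lambda>k. 0)"
  obtains C :: real where "C > 0"
    "\<And>f. f \<in> tempered \<Longrightarrow> orlicz_norm \<Phi>\<^sub>1 f \<le> ennreal C * mixed_norm \<Phi>\<^sub>1 \<Phi>\<^sub>2 (stft g f)"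
proof -
  interpret G1: orlicz_gauge \<Phi>\<^sub>1 by fact
  obtain j where j: "g j \<noteq> 0" using g by auto
  obtain D :: real where D: "D > 0" "\<And>F :: (int ^ 'n) \<times> (real ^ 'n) \<Rightarrow> complex. F \<in> borel_measurable (count_space UNIV \<Otimes>\<^sub>M torus) \<Longrightarrow>
       luxemburg_norm \<Phi>\<^sub>1 (count_space UNIV) (\<lambda>m. \<integral>\<^sup>+w. ennreal (cmod (F (m, w))) \<partial>torus)
         \<le> ennreal D * mixed_norm \<Phi>\<^sub>1 \<Phi>\<^sub>2 F"
    using luxemburg_integral_le_mixed_norm[OF assms(1,2) emeasure_torus_le] by blast
  show thesis
  proof (rule that[of "1 / cmod (g j) * D"])
    show "1 / cmod (g j) * D > 0" using D j by simp
    fix f :: "int ^ 'n \<Rightarrow> complex" assume f: "f \<in> tempered"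
    let ?A = "\<lambda>m. \<integral>\<^sup>+w. ennreal (cmod (stft g f (m, w))) \<partial>torus"
    have "ennreal (cmod (f k)) \<le> ennreal (1 / cmod (g j)) * ?A (k - j)" for k
    proof -
      have "ennreal (cmod (f k * cnj (g (k - (k - j))))) \<le> (\<integral>\<^sup>+w. ennreal (cmod (stft g f (k - j, w) * character w k)) \<partial>torus)"
        unfolding stft_inversion[OF f g(1), symmetric] by (rule norm_integral_le_nn_integral)
      then have "ennreal (cmod (f k) * cmod (g j)) \<le> ?A (k - j)" by (simp add: norm_mult)
      then have "ennreal (1 / cmod (g j)) * ennreal (cmod (f k) * cmod (g j)) \<le> ennreal (1 / cmod (g j)) * ?A (k - j)"
        by (rule mult_left_mono) simp
      then show ?thesis using j by (simp add: ennreal_mult[symmetric])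
    qed
    then have "orlicz_norm \<Phi>\<^sub>1 f \<le> luxemburg_norm \<Phi>\<^sub>1 (count_space UNIV) (\<lambda>k. ennreal (1 / cmod (g j)) * ?A (k - j))"
      by (intro G1.luxemburg_mono)
    also have "\<dots> \<le> ennreal (1 / cmod (g j)) * luxemburg_norm \<Phi>\<^sub>1 (count_space UNIV) (\<lambda>k. ?A (k - j))"
      by (rule G1.luxemburg_cmult_le) simp
    also have "\<dots> = ennreal (1 / cmod (g j)) * luxemburg_norm \<Phi>\<^sub>1 (count_space UNIV) ?A"
      by (simp only: G1.luxemburg_bij[OF bij_minus_const, where f = ?A])
    also have "\<dots> \<le> ennreal (1 / cmod (g j)) * (ennreal D * mixed_norm \<Phi>\<^sub>1 \<Phi>\<^sub>2 (stft g f))"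
      by (intro mult_left_mono D stft_measurable f g) simp
    also have "\<dots> = ennreal (1 / cmod (g j) * D) * mixed_norm \<Phi>\<^sub>1 \<Phi>\<^sub>2 (stft g f)"
      using D by (subst ennreal_mult) (auto simp: mult.assoc)
    finally show "orlicz_norm \<Phi>\<^sub>1 f \<le> ennreal (1 / cmod (g j) * D) * mixed_norm \<Phi>\<^sub>1 \<Phi>\<^sub>2 (stft g f)" .
  qed
qed

text \<open>Applied to the Young functions and to their complements, this makes both sides of the
  duality explicit sequence spaces. Temperedness and measurability of the transform come with a
  finite Orlicz norm.\<close>

lemma modulation_space_eq:
  fixes g :: "int ^ 'n::finite \<Rightarrow> complex"
  assumes "orlicz_gauge \<Phi>\<^sub>1" "orlicz_gauge \<Phi>\<^sub>2" and g: "g \<in> schwartz" "g \<noteq> (\<lambda>k. 0)"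
  shows "modulation_space g \<Phi>\<^sub>1 \<Phi>\<^sub>2 = {f. orlicz_norm \<Phi>\<^sub>1 f < \<infinity>}"
proof -
  obtain C :: real where C: "C > 0"
    "\<And>f. orlicz_norm \<Phi>\<^sub>1 f < \<infinity> \<Longrightarrow> mixed_norm \<Phi>\<^sub>1 \<Phi>\<^sub>2 (stft g f) \<le> ennreal C * orlicz_norm \<Phi>\<^sub>1 f"
    using mixed_norm_stft_le[OF assms(1-3)] by blast
  obtain D :: real where D: "D > 0"
    "\<And>f. f \<in> tempered \<Longrightarrow> orlicz_norm \<Phi>\<^sub>1 f \<le> ennreal D * mixed_norm \<Phi>\<^sub>1 \<Phi>\<^sub>2 (stft g f)"
    using orlicz_norm_le_mixed_norm_stft[OF assms] by blast
  show ?thesis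
  proof (intro equalityI subsetI CollectI)
    fix f assume "f \<in> modulation_space g \<Phi>\<^sub>1 \<Phi>\<^sub>2"
    then have "f \<in> tempered" "mixed_norm \<Phi>\<^sub>1 \<Phi>\<^sub>2 (stft g f) < \<infinity>"
      unfolding modulation_space_def mixed_orlicz_def by auto
    then show "orlicz_norm \<Phi>\<^sub>1 f < \<infinity>"
      using D(2)[of f] by (auto simp: ennreal_mult_less_top intro: le_less_trans)
  next
    fix f :: "int ^ 'n \<Rightarrow> complex" assume "f \<in> {f. orlicz_norm \<Phi>\<^sub>1 f < \<infinity>}"
    then have f: "orlicz_norm \<Phi>\<^sub>1 f < \<infinity>" by simp
    then have "f \<in> tempered" using orlicz_gauge.orlicz_norm_finite_tempered[OF assms(1)] by blast
    moreover have "mixed_norm \<Phi>\<^sub>1 \<Phi>\<^sub>2 (stft g f) < \<infinity>"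
      using C(2)[OF f] f by (auto simp: ennreal_mult_less_top intro: le_less_trans)
    ultimately show "f \<in> modulation_space g \<Phi>\<^sub>1 \<Phi>\<^sub>2"
      unfolding modulation_space_def mixed_orlicz_def using stft_measurable g by blast
  qed
qed

lemma nn_integral_reflect:
  fixes S :: "'a :: ab_group_add \<Rightarrow> ennreal"
  shows "(\<integral>\<^sup>+m. c (k - m) * S m \<partial>count_space UNIV) = (\<integral>\<^sup>+j. c j * S (k - j) \<partial>count_space UNIV)"
  using nn_integral_bij_count_space[OF bij_const_minus[of k], of "\<lambda>m. c m * S (k - m)"] by simp

text \<open>Counterpart for synthesis of the bound on the transform: the kernel
  \<open>g (k - m)\<close> is reflected by \<open>nn_integral_reflect\<close> into a weighted sum of
  shifts of \<open>S\<close>.\<close>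

lemma luxemburg_window_convolution:
  fixes g :: "int ^ 'n::finite \<Rightarrow> complex"
  assumes "orlicz_gauge \<Phi>" "g \<in> schwartz"
  obtains C :: real where "C > 0"
    "\<And>S. luxemburg_norm \<Phi> (count_space UNIV) (\<lambda>k. \<integral>\<^sup>+m. ennreal (cmod (g (k - m))) * S m \<partial>count_space UNIV)
      \<le> ennreal C * luxemburg_norm \<Phi> (count_space UNIV) S"
proof -
  interpret orlicz_gauge \<Phi> by fact
  obtain r where r: "r \<ge> 0" "(\<integral>\<^sup>+j. ennreal (cmod (g j)) \<partial>count_space UNIV) = ennreal r"
    using nn_integral_cmod_eq[OF assms(2)] .
  show thesis
  proof (rule that[of "4 * r + 1"])
    show "4 * r + 1 > 0" using r by simp
    fix S :: "int ^ 'n \<Rightarrow> ennreal"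
    have "luxemburg_norm \<Phi> (count_space UNIV) (\<lambda>k. \<integral>\<^sup>+m. ennreal (cmod (g (k - m))) * S m \<partial>count_space UNIV)
        \<le> 4 * ennreal r * luxemburg_norm \<Phi> (count_space UNIV) S"
      unfolding nn_integral_reflect[of "\<lambda>m. ennreal (cmod (g m))"] r(2)[symmetric]
      using luxemburg_convolution_le[of "\<lambda>j m. m - j" "\<lambda>j. cmod (g j)" S, OF bij_minus_const norm_ge_zero] .
    also have "4 * ennreal r = ennreal (4 * r)" using r ennreal_mult[of 4 r] by simp
    also have "ennreal (4 * r) * luxemburg_norm \<Phi> (count_space UNIV) S \<le> ennreal (4 * r + 1) * luxemburg_norm \<Phi> (count_space UNIV) S"
      by (intro mult_right_mono ennreal_leI) auto
    finally show "luxemburg_norm \<Phi> (count_space UNIV) (\<lambda>k. \<integral>\<^sup>+m. ennreal (cmod (g (k - m))) * S m \<partial>count_space UNIV)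
      \<le> ennreal (4 * r + 1) * luxemburg_norm \<Phi> (count_space UNIV) S" .
  qed
qed

section \<open>Duality and localization operators\<close>

lemma window_convolution_finite:
  fixes g :: "int ^ 'n::finite \<Rightarrow> complex"
  assumes "orlicz_gauge \<Phi>" "g \<in> schwartz" "luxemburg_norm \<Phi> (count_space UNIV) S < \<infinity>"
  shows "(\<integral>\<^sup>+m. ennreal (cmod (g (k - m))) * S m \<partial>count_space UNIV) < \<infinity>"
proof -
  interpret orlicz_gauge \<Phi> by fact
  obtain C :: real where C: "C > 0"
    "\<And>S. luxemburg_norm \<Phi> (count_space UNIV) (\<lambda>k. \<integral>\<^sup>+m. ennreal (cmod (g (k - m))) * S m \<partial>count_space UNIV)
      \<le> ennreal C * luxemburg_norm \<Phi> (count_space UNIV) S"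
    using luxemburg_window_convolution[OF assms(1,2)] by blast
  obtain t :: real where t: "t > 0" "1 \<le> \<Phi> (ennreal t)" using large by auto
  have "(\<integral>\<^sup>+m. ennreal (cmod (g (k - m))) * S m \<partial>count_space UNIV)
      \<le> ennreal t * luxemburg_norm \<Phi> (count_space UNIV) (\<lambda>k. \<integral>\<^sup>+m. ennreal (cmod (g (k - m))) * S m \<partial>count_space UNIV)"
    by (rule le_luxemburg[OF t])
  also have "\<dots> \<le> ennreal t * (ennreal C * luxemburg_norm \<Phi> (count_space UNIV) S)"
    by (intro mult_left_mono C) simp
  also have "\<dots> < \<infinity>" using assms(3) by (simp add: ennreal_mult_less_top)
  finally show ?thesis .
qed

text \<open>The convolution of \<open>cmod g\<close> with the torus integrals of
  \<open>cmod F\<close> dominates. Additivity of the synthesis depends on this convergence.\<close>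

lemma synthesis_integrable:
  fixes g :: "int ^ 'n::finite \<Rightarrow> complex" and F :: "(int ^ 'n) \<times> (real ^ 'n) \<Rightarrow> complex"
  assumes "orlicz_gauge \<Phi>" "g \<in> schwartz"
    and "luxemburg_norm \<Phi> (count_space UNIV) (\<lambda>m. \<integral>\<^sup>+w. ennreal (cmod (F (m, w))) \<partial>torus) < \<infinity>"
  shows "integrable (count_space UNIV) (\<lambda>m. g (k - m) * (\<integral>w. F (m, w) * character w k \<partial>torus))"
proof (rule integrableI_bounded)
  have "(\<integral>\<^sup>+m. ennreal (norm (g (k - m) * (\<integral>w. F (m, w) * character w k \<partial>torus))) \<partial>count_space UNIV)
    \<le> (\<integral>\<^sup>+m. ennreal (cmod (g (k - m))) * (\<integral>\<^sup>+w. ennreal (cmod (F (m, w))) \<partial>torus) \<partial>count_space UNIV)"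
  proof (rule nn_integral_mono)
    fix m
    have "ennreal (cmod (\<integral>w. F (m, w) * character w k \<partial>torus)) \<le> (\<integral>\<^sup>+w. ennreal (cmod (F (m, w))) \<partial>torus)"
      using norm_integral_le_nn_integral[of torus "\<lambda>w. F (m, w) * character w k"] by (simp add: norm_mult)
    then show "ennreal (norm (g (k - m) * (\<integral>w. F (m, w) * character w k \<partial>torus)))
      \<le> ennreal (cmod (g (k - m))) * (\<integral>\<^sup>+w. ennreal (cmod (F (m, w))) \<partial>torus)"
      unfolding norm_mult by (subst ennreal_mult) (auto intro: mult_left_mono)
  qed
  also have "\<dots> < \<infinity>" by (rule window_convolution_finite[OF assms])
  finally show "(\<integral>\<^sup>+m. ennreal (norm (g (k - m) * (\<integral>w. F (m, w) * character w k \<partial>torus))) \<partial>count_space UNIV) < \<infinity>" .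
qed simp

text \<open>The transform is moved to the other side as its adjoint, synthesis with
  \<open>g\<close>. The torus integral is interchanged with the series in \<open>k\<close> for fixed
  \<open>m\<close>, then the two lattice sums with each other; the latter rests on Hoelder's
  inequality for \<open>h\<close> against the convolution of \<open>cmod g\<close> with the torus
  integrals of \<open>cmod F\<close>. With \<open>F = stft g u\<close> this computes the pairing,
  with \<open>\<sigma>\<close> times a transform the localization form.\<close>

lemma stft_pairing:
  fixes g h :: "int ^ 'n::finite \<Rightarrow> complex" and F :: "(int ^ 'n) \<times> (real ^ 'n) \<Rightarrow> complex"
  assumes orlicz_gauge: "orlicz_gauge \<Phi>" "orlicz_gauge (complementary \<Phi>)" and g: "g \<in> schwartz"
    and h: "orlicz_norm (complementary \<Phi>) h < \<infinity>"
    and F[measurable]: "F \<in> borel_measurable (count_space UNIV \<Otimes>\<^sub>M torus)"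
    and S: "luxemburg_norm \<Phi> (count_space UNIV) (\<lambda>m. \<integral>\<^sup>+w. ennreal (cmod (F (m, w))) \<partial>torus) < \<infinity>"
  shows "(\<Sum>\<^sub>\<infinity>m. \<integral>w. F (m, w) * cnj (stft g h (m, w)) \<partial>torus)
    = (\<integral>k. cnj (h k) * (\<integral>m. g (k - m) * (\<integral>w. F (m, w) * character w k \<partial>torus) \<partial>count_space UNIV) \<partial>count_space UNIV)"
proof -
  interpret G: orlicz_gauge \<Phi> by fact
  interpret H: orlicz_gauge "complementary \<Phi>" by fact
  let ?S = "\<lambda>m. \<integral>\<^sup>+w. ennreal (cmod (F (m, w))) \<partial>torus"
  let ?F = "\<lambda>m k. \<integral>w. F (m, w) * character w k \<partial>torus"
  obtain t :: real where t: "t > 0" "1 \<le> \<Phi> (ennreal t)" using G.large by auto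
  have Fm: "(\<lambda>w. F (m, w)) \<in> borel_measurable torus" for m by measurable
  have S_fin: "?S m < \<infinity>" for m
    using G.le_luxemburg[OF t, of ?S m] S by (auto simp: ennreal_mult_less_top intro: le_less_trans)
  have F_int: "integrable torus (\<lambda>w. F (m, w))" for m
    using Fm S_fin[of m] by (intro integrableI_bounded) auto
  have F_le: "ennreal (cmod (?F m k)) \<le> ?S m" for m k
    using norm_integral_le_nn_integral[of torus "\<lambda>w. F (m, w) * character w k"] by (simp add: norm_mult)
  have ht: "h \<in> tempered" by (rule H.orlicz_norm_finite_tempered[OF h])
  define U where "U m k = cnj (h k) * g (k - m) * ?F m k" for m k
  have inner: "(\<integral>w. F (m, w) * cnj (stft g h (m, w)) \<partial>torus) = (\<integral>k. U m k \<partial>count_space UNIV)" for m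
  proof -
    note int = tempered_window_integrable[OF ht g, of m]
    have int': "integrable (count_space UNIV) (\<lambda>k. cnj (h k) * g (k - m))"
      using integrable_cnj[OF int] by simp
    have "cnj (stft g h (m, w)) = (\<integral>k. cnj (h k) * g (k - m) * character w k \<partial>count_space UNIV)" for w
      unfolding stft_eq_integral[OF int] by (subst Bochner_Integration.integral_cnj[symmetric]) simp
    then show ?thesis unfolding U_def
      using fubini_count_space[OF torus_sigma_finite F_int[of m] int' character_measurable] by simp
  qed
  interpret C: sigma_finite_measure "count_space (UNIV :: (int ^ 'n) set)" by (rule sigma_finite_measure_count_space)
  interpret P: pair_sigma_finite "count_space (UNIV :: (int ^ 'n) set)" "count_space (UNIV :: (int ^ 'n) set)" by standard
  have int: "integrable (count_space UNIV \<Otimes>\<^sub>M count_space UNIV) (case_prod U)"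
  proof (rule integrableI_bounded)
    show meas: "case_prod U \<in> borel_measurable (count_space UNIV \<Otimes>\<^sub>M count_space UNIV)"
      by (rule measurable_pair_measure_countable1) (auto intro: countableI_type)
    let ?V = "\<lambda>k. \<integral>\<^sup>+m. ennreal (cmod (g (k - m))) * ?S m \<partial>count_space UNIV"
    have "(\<integral>\<^sup>+x. ennreal (norm (case_prod U x)) \<partial>(count_space UNIV \<Otimes>\<^sub>M count_space UNIV))
        = (\<integral>\<^sup>+k. (\<integral>\<^sup>+m. ennreal (norm (case_prod U (m, k))) \<partial>count_space UNIV) \<partial>count_space UNIV)"
      by (rule P.nn_integral_snd[symmetric]) (use meas in measurable)
    also have "\<dots> \<le> (\<integral>\<^sup>+k. ?V k * ennreal (cmod (h k)) \<partial>count_space UNIV)"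
    proof (rule nn_integral_mono)
      fix k
      have "ennreal (norm (U m k)) \<le> ennreal (cmod (h k)) * (ennreal (cmod (g (k - m))) * ?S m)" for m
        using F_le[of m k] unfolding U_def norm_mult complex_mod_cnj
        by (simp add: ennreal_mult mult.assoc mult_left_mono)
      then have "(\<integral>\<^sup>+m. ennreal (norm (U m k)) \<partial>count_space UNIV)
          \<le> (\<integral>\<^sup>+m. ennreal (cmod (h k)) * (ennreal (cmod (g (k - m))) * ?S m) \<partial>count_space UNIV)"
        by (intro nn_integral_mono)
      also have "\<dots> = ?V k * ennreal (cmod (h k))" by (subst nn_integral_cmult) (auto simp: mult.commute)
      finally show "(\<integral>\<^sup>+m. ennreal (norm (case_prod U (m, k))) \<partial>count_space UNIV) \<le> ?V k * ennreal (cmod (h k))" by simp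
    qed
    also have "\<dots> < \<infinity>"
    proof (rule luxemburg_holder[OF orlicz_gauge window_convolution_finite[OF orlicz_gauge(1) g S] _ h])
      obtain C :: real where C: "C > 0"
        "\<And>S. luxemburg_norm \<Phi> (count_space UNIV) (\<lambda>k. \<integral>\<^sup>+m. ennreal (cmod (g (k - m))) * S m \<partial>count_space UNIV)
          \<le> ennreal C * luxemburg_norm \<Phi> (count_space UNIV) S"
        using luxemburg_window_convolution[OF orlicz_gauge(1) g] by blast
      have "luxemburg_norm \<Phi> (count_space UNIV) ?V \<le> ennreal C * luxemburg_norm \<Phi> (count_space UNIV) ?S" by (rule C(2))
      also have "\<dots> < \<infinity>" using S by (simp add: ennreal_mult_less_top)
      finally show "luxemburg_norm \<Phi> (count_space UNIV) ?V < \<infinity>" .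
    qed
    finally show "(\<integral>\<^sup>+x. ennreal (norm (case_prod U x)) \<partial>(count_space UNIV \<Otimes>\<^sub>M count_space UNIV)) < \<infinity>" .
  qed
  have "(\<Sum>\<^sub>\<infinity>m. \<integral>w. F (m, w) * cnj (stft g h (m, w)) \<partial>torus) = (\<Sum>\<^sub>\<infinity>m. \<integral>k. U m k \<partial>count_space UNIV)"
    by (simp add: inner)
  also have "\<dots> = (\<integral>m. \<integral>k. U m k \<partial>count_space UNIV \<partial>count_space UNIV)"
    using P.integrable_fst[OF int] by (rule infsum_eq_integral)
  also have "\<dots> = (\<integral>k. \<integral>m. U m k \<partial>count_space UNIV \<partial>count_space UNIV)"
    by (rule P.Fubini_integral[OF int, symmetric])
  also have "\<dots> = (\<integral>k. cnj (h k) * (\<integral>m. g (k - m) * ?F m k \<partial>count_space UNIV) \<partial>count_space UNIV)"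
    unfolding U_def by (simp add: mult.assoc)
  finally show ?thesis .
qed

text \<open>The squared l^2 norm of the window, with a complex value because it is a factor in
  complex identities.\<close>

definition window_energy :: "(int ^ 'n::finite \<Rightarrow> complex) \<Rightarrow> complex" where
  "window_energy g = (\<integral>m. g m * cnj (g m) \<partial>count_space UNIV)"

text \<open>One non-zero value of \<open>g\<close> contributes a positive term to a sum of
  non-negative ones; integrability comes from pairing the bounded sequence \<open>g\<close> with
  itself.\<close>

lemma window_energy_nonzero:
  assumes "g \<in> schwartz" "g \<noteq> (\<lambda>k. 0)"
  shows "window_energy g \<noteq> 0"
proof -
  obtain C where C: "C \<ge> 0" "\<And>k. cmod (g k) \<le> C / (1 + norm (real_vec k)) ^ 0"
    using schwartz_bound[OF assms(1)] by blast
  have "g \<in> tempered" using C by (intro bounded_tempered[of g C]) simp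
  then have int: "integrable (count_space UNIV) (\<lambda>m. g m * cnj (g m))" using assms(1) by (rule tempered_integrable)
  have eq: "g m * cnj (g m) = complex_of_real ((cmod (g m))\<^sup>2)" for m
    using complex_norm_square[of "g m"] by simp
  have int': "integrable (count_space UNIV) (\<lambda>m. (cmod (g m))\<^sup>2)" using integrable_norm[OF int] by (simp add: norm_mult power2_eq_square)
  obtain j where j: "g j \<noteq> 0" using assms by auto
  have "0 < ennreal ((cmod (g j))\<^sup>2)" using j by simp
  also have "\<dots> \<le> (\<integral>\<^sup>+m. ennreal ((cmod (g m))\<^sup>2) \<partial>count_space UNIV)" by (rule nn_integral_ge_point) simp
  also have "\<dots> = ennreal (\<integral>m. (cmod (g m))\<^sup>2 \<partial>count_space UNIV)" using int' by (intro nn_integral_eq_integral) auto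
  finally have "(\<integral>m. (cmod (g m))\<^sup>2 \<partial>count_space UNIV) \<noteq> 0" by auto
  then show ?thesis unfolding window_energy_def eq by (simp del: of_real_power)
qed

text \<open>Inversion replaces the inner torus integral by \<open>u k * cnj (g (k - m))\<close>, and
  summing \<open>g (k - m) * cnj (g (k - m))\<close> over \<open>m\<close> gives the window energy
  for every \<open>k\<close>.\<close>

lemma duality_pairing_eq:
  fixes g u h :: "int ^ 'n::finite \<Rightarrow> complex"
  assumes orlicz_gauge: "orlicz_gauge \<Phi>\<^sub>1" "orlicz_gauge (complementary \<Phi>\<^sub>1)" "orlicz_gauge \<Phi>\<^sub>2" and g: "g \<in> schwartz"
    and u: "orlicz_norm \<Phi>\<^sub>1 u < \<infinity>" and h: "orlicz_norm (complementary \<Phi>\<^sub>1) h < \<infinity>"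
  shows "duality_pairing g u h = window_energy g * (\<integral>k. cnj (h k) * u k \<partial>count_space UNIV)"
proof -
  have ut: "u \<in> tempered" using orlicz_gauge.orlicz_norm_finite_tempered[OF orlicz_gauge(1) u] .
  note meas = stft_measurable[OF ut g]
  have S: "luxemburg_norm \<Phi>\<^sub>1 (count_space UNIV) (\<lambda>m. \<integral>\<^sup>+w. ennreal (cmod (stft g u (m, w))) \<partial>torus) < \<infinity>"
  proof -
    obtain D :: real where "D > 0" "\<And>F :: (int ^ 'n) \<times> (real ^ 'n) \<Rightarrow> complex. F \<in> borel_measurable (count_space UNIV \<Otimes>\<^sub>M torus) \<Longrightarrow>
       luxemburg_norm \<Phi>\<^sub>1 (count_space UNIV) (\<lambda>m. \<integral>\<^sup>+w. ennreal (cmod (F (m, w))) \<partial>torus)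
         \<le> ennreal D * mixed_norm \<Phi>\<^sub>1 \<Phi>\<^sub>2 F"
      using luxemburg_integral_le_mixed_norm[OF orlicz_gauge(1,3) emeasure_torus_le] by blast
    then have "luxemburg_norm \<Phi>\<^sub>1 (count_space UNIV) (\<lambda>m. \<integral>\<^sup>+w. ennreal (cmod (stft g u (m, w))) \<partial>torus)
        \<le> ennreal D * mixed_norm \<Phi>\<^sub>1 \<Phi>\<^sub>2 (stft g u)" using meas by blast
    also have "\<dots> < \<infinity>"
    proof -
      obtain C :: real where C: "C > 0"
        "\<And>f. orlicz_norm \<Phi>\<^sub>1 f < \<infinity> \<Longrightarrow> mixed_norm \<Phi>\<^sub>1 \<Phi>\<^sub>2 (stft g f) \<le> ennreal C * orlicz_norm \<Phi>\<^sub>1 f"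
        using mixed_norm_stft_le[OF orlicz_gauge(1,3) g] by blast
      have "mixed_norm \<Phi>\<^sub>1 \<Phi>\<^sub>2 (stft g u) < \<infinity>"
        using C(2)[OF u] by (rule le_less_trans) (use u in \<open>simp add: ennreal_mult_less_top\<close>)
      then show ?thesis by (simp add: ennreal_mult_less_top)
    qed
    finally show ?thesis .
  qed
  have inner: "(\<integral>m. g (k - m) * (\<integral>w. stft g u (m, w) * character w k \<partial>torus) \<partial>count_space UNIV) = window_energy g * u k" for k
  proof -
    have "(\<integral>m. g (k - m) * (\<integral>w. stft g u (m, w) * character w k \<partial>torus) \<partial>count_space UNIV)
        = (\<integral>m. (g (k - m) * cnj (g (k - m))) * u k \<partial>count_space UNIV)"
      unfolding stft_inversion[OF ut g] by (simp add: mult_ac)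
    also have "\<dots> = (\<integral>m. g (k - m) * cnj (g (k - m)) \<partial>count_space UNIV) * u k" by simp
    also have "(\<integral>m. g (k - m) * cnj (g (k - m)) \<partial>count_space UNIV) = window_energy g"
      unfolding window_energy_def
      using infsetsum_reindex_bij_betw[OF bij_const_minus[of k], of "\<lambda>m. g m * cnj (g m)"]
      unfolding infsetsum_def .
    finally show ?thesis .
  qed
  have "duality_pairing g u h = (\<integral>k. cnj (h k) * (window_energy g * u k) \<partial>count_space UNIV)"
    unfolding duality_pairing_def stft_pairing[OF orlicz_gauge(1,2) g h meas S] inner ..
  also have "\<dots> = (\<integral>k. window_energy g * (cnj (h k) * u k) \<partial>count_space UNIV)" by (simp add: mult_ac)
  finally show ?thesis by simp
qed

lemma duality_pairing_inject:
  fixes g u v :: "int ^ 'n::finite \<Rightarrow> complex"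
  assumes orlicz_gauge: "orlicz_gauge \<Phi>\<^sub>1" "orlicz_gauge (complementary \<Phi>\<^sub>1)" "orlicz_gauge \<Phi>\<^sub>2" and g: "g \<in> schwartz" "g \<noteq> (\<lambda>k. 0)"
    and u: "orlicz_norm \<Phi>\<^sub>1 u < \<infinity>" and v: "orlicz_norm \<Phi>\<^sub>1 v < \<infinity>"
    and eq: "\<And>h. orlicz_norm (complementary \<Phi>\<^sub>1) h < \<infinity> \<Longrightarrow> duality_pairing g u h = duality_pairing g v h"
  shows "u = v"
proof
  fix l :: "int ^ 'n"
  let ?d = "\<lambda>k. if k = l then 1 else 0 :: complex"
  have d: "orlicz_norm (complementary \<Phi>\<^sub>1) ?d < \<infinity>" by (rule orlicz_gauge.orlicz_norm_delta[OF orlicz_gauge(2)])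
  have val: "(\<integral>k. cnj (?d k) * f k \<partial>count_space UNIV) = f l" for f :: "int ^ 'n \<Rightarrow> complex"
  proof -
    have "(\<lambda>k. cnj (?d k) * f k) = (\<lambda>k. if k = l then f k else 0)" by auto
    then show ?thesis using integral_count_space_delta[of l f] by simp
  qed
  have "window_energy g * u l = window_energy g * v l"
    using eq[OF d] unfolding duality_pairing_eq[OF orlicz_gauge g(1) u d] duality_pairing_eq[OF orlicz_gauge g(1) v d] val .
  then show "u l = v l" using window_energy_nonzero[OF g] by simp
qed

section \<open>The representing sequence of the localization form\<close>

text \<open>The inverse window energy compensates the factor that \<open>duality_pairing_eq\<close>
  produces.\<close>

definition localization_synthesis ::
  "(int ^ 'n::finite \<Rightarrow> complex) \<Rightarrow> (int ^ 'n \<Rightarrow> complex) \<Rightarrow> (int ^ 'n \<Rightarrow> complex)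
    \<Rightarrow> ((int ^ 'n) \<times> (real ^ 'n) \<Rightarrow> complex) \<Rightarrow> (int ^ 'n \<Rightarrow> complex) \<Rightarrow> int ^ 'n \<Rightarrow> complex" where
  "localization_synthesis g\<^sub>0 g\<^sub>1 g\<^sub>2 \<sigma> f k = inverse (window_energy g\<^sub>0) *
     (\<integral>m. g\<^sub>2 (k - m) * (\<integral>w. \<sigma> (m, w) * stft g\<^sub>1 f (m, w) * character w k \<partial>torus) \<partial>count_space UNIV)"

text \<open>The transform of \<open>f\<close> is bounded in both variables by a multiple of the norm
  of \<open>f\<close>, so it can be pulled out as a constant and \<open>\<sigma>\<close> alone
  carries the mixed norm. In the constant, \<open>r + 1\<close> replaces the l^1 norm
  \<open>r\<close> of the window to stay positive.\<close>

lemma luxemburg_symbol_stft_le: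
  fixes g :: "int ^ 'n::finite \<Rightarrow> complex"
  assumes orlicz_gauge: "orlicz_gauge \<Phi>\<^sub>1" "orlicz_gauge \<Phi>\<^sub>2" and g: "g \<in> schwartz"
  obtains C :: real where "C > 0"
    "\<And>\<sigma> f. \<sigma> \<in> mixed_orlicz \<Phi>\<^sub>1 \<Phi>\<^sub>2 \<Longrightarrow> orlicz_norm \<Phi>\<^sub>1 f < \<infinity> \<Longrightarrow>
      luxemburg_norm \<Phi>\<^sub>1 (count_space UNIV) (\<lambda>m. \<integral>\<^sup>+w. ennreal (cmod (\<sigma> (m, w) * stft g f (m, w))) \<partial>torus)
        \<le> ennreal C * (mixed_norm \<Phi>\<^sub>1 \<Phi>\<^sub>2 \<sigma> * orlicz_norm \<Phi>\<^sub>1 f)"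
proof -
  interpret G1: orlicz_gauge \<Phi>\<^sub>1 by fact
  obtain t :: real where t: "t > 0" "1 \<le> \<Phi>\<^sub>1 (ennreal t)" using G1.large by auto
  obtain r where r: "r \<ge> 0" "(\<integral>\<^sup>+j. ennreal (cmod (g j)) \<partial>count_space UNIV) = ennreal r"
    using nn_integral_cmod_eq[OF g] .
  obtain D :: real where D: "D > 0" "\<And>F :: (int ^ 'n) \<times> (real ^ 'n) \<Rightarrow> complex. F \<in> borel_measurable (count_space UNIV \<Otimes>\<^sub>M torus) \<Longrightarrow>
       luxemburg_norm \<Phi>\<^sub>1 (count_space UNIV) (\<lambda>m. \<integral>\<^sup>+w. ennreal (cmod (F (m, w))) \<partial>torus)
         \<le> ennreal D * mixed_norm \<Phi>\<^sub>1 \<Phi>\<^sub>2 F"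
    using luxemburg_integral_le_mixed_norm[OF orlicz_gauge emeasure_torus_le] by blast
  show thesis
  proof (rule that[of "(r + 1) * t * D"])
    show "(r + 1) * t * D > 0" using r t D by simp
    fix \<sigma> :: "(int ^ 'n) \<times> (real ^ 'n) \<Rightarrow> complex" and f :: "int ^ 'n \<Rightarrow> complex"
    assume \<sigma>: "\<sigma> \<in> mixed_orlicz \<Phi>\<^sub>1 \<Phi>\<^sub>2" and f: "orlicz_norm \<Phi>\<^sub>1 f < \<infinity>"
    note ft = G1.orlicz_norm_finite_tempered[OF f]
    have [measurable]: "\<sigma> \<in> borel_measurable (count_space UNIV \<Otimes>\<^sub>M torus)" using \<sigma> unfolding mixed_orlicz_def by simp
    obtain x where x: "orlicz_norm \<Phi>\<^sub>1 f = ennreal x" "x \<ge> 0" using f by (cases "orlicz_norm \<Phi>\<^sub>1 f") auto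
    let ?B = "(r + 1) * t * x"
    have B0: "?B \<ge> 0" using r t x by simp
    have stft_le: "ennreal (cmod (stft g f (m, w))) \<le> ennreal ?B" for m w
    proof -
      have "ennreal (cmod (stft g f (m, w))) \<le> (\<integral>\<^sup>+j. ennreal (cmod (g j)) * ennreal (cmod (f (m + j))) \<partial>count_space UNIV)"
        by (rule cmod_stft_le[OF ft g])
      also have "\<dots> \<le> (\<integral>\<^sup>+j. ennreal (cmod (g j)) * ennreal (t * x) \<partial>count_space UNIV)"
        using G1.le_luxemburg[OF t, of "\<lambda>m. ennreal (cmod (f m))"] x t
        by (intro nn_integral_mono mult_left_mono) (auto simp: ennreal_mult)
      also have "\<dots> = ennreal (r * (t * x))" using r t x by (simp add: nn_integral_multc ennreal_mult)
      also have "\<dots> \<le> ennreal ?B" using t x by (intro ennreal_leI) (simp add: distrib_right mult.assoc)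
      finally show ?thesis .
    qed
    have "(\<integral>\<^sup>+w. ennreal (cmod (\<sigma> (m, w) * stft g f (m, w))) \<partial>torus)
        \<le> ennreal ?B * (\<integral>\<^sup>+w. ennreal (cmod (\<sigma> (m, w))) \<partial>torus)" for m
    proof -
      have "(\<integral>\<^sup>+w. ennreal (cmod (\<sigma> (m, w) * stft g f (m, w))) \<partial>torus)
          \<le> (\<integral>\<^sup>+w. ennreal ?B * ennreal (cmod (\<sigma> (m, w))) \<partial>torus)"
        using stft_le by (intro nn_integral_mono) (simp add: norm_mult ennreal_mult mult.commute[of "ennreal (cmod (\<sigma> _))"] mult_right_mono)
      also have "\<dots> = ennreal ?B * (\<integral>\<^sup>+w. ennreal (cmod (\<sigma> (m, w))) \<partial>torus)"
        by (rule nn_integral_cmult) measurable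
      finally show ?thesis .
    qed
    then have "luxemburg_norm \<Phi>\<^sub>1 (count_space UNIV) (\<lambda>m. \<integral>\<^sup>+w. ennreal (cmod (\<sigma> (m, w) * stft g f (m, w))) \<partial>torus)
        \<le> luxemburg_norm \<Phi>\<^sub>1 (count_space UNIV) (\<lambda>m. ennreal ?B * (\<integral>\<^sup>+w. ennreal (cmod (\<sigma> (m, w))) \<partial>torus))"
      by (intro G1.luxemburg_mono)
    also have "\<dots> \<le> ennreal ?B * luxemburg_norm \<Phi>\<^sub>1 (count_space UNIV) (\<lambda>m. \<integral>\<^sup>+w. ennreal (cmod (\<sigma> (m, w))) \<partial>torus)"
      using B0 by (rule G1.luxemburg_cmult_le)
    also have "\<dots> \<le> ennreal ?B * (ennreal D * mixed_norm \<Phi>\<^sub>1 \<Phi>\<^sub>2 \<sigma>)"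
      by (intro mult_left_mono D) measurable
    also have "\<dots> = ennreal ((r + 1) * t * D) * (mixed_norm \<Phi>\<^sub>1 \<Phi>\<^sub>2 \<sigma> * orlicz_norm \<Phi>\<^sub>1 f)"
      using r t x D by (simp add: ennreal_mult ac_simps)
    finally show "luxemburg_norm \<Phi>\<^sub>1 (count_space UNIV) (\<lambda>m. \<integral>\<^sup>+w. ennreal (cmod (\<sigma> (m, w) * stft g f (m, w))) \<partial>torus)
        \<le> ennreal ((r + 1) * t * D) * (mixed_norm \<Phi>\<^sub>1 \<Phi>\<^sub>2 \<sigma> * orlicz_norm \<Phi>\<^sub>1 f)" .
  qed
qed

lemma luxemburg_symbol_stft_finite:
  fixes g :: "int ^ 'n::finite \<Rightarrow> complex"
  assumes orlicz_gauge: "orlicz_gauge \<Phi>\<^sub>1" "orlicz_gauge \<Phi>\<^sub>2" and g: "g \<in> schwartz"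
    and \<sigma>: "\<sigma> \<in> mixed_orlicz \<Phi>\<^sub>1 \<Phi>\<^sub>2" and f: "orlicz_norm \<Phi>\<^sub>1 f < \<infinity>"
  shows "luxemburg_norm \<Phi>\<^sub>1 (count_space UNIV) (\<lambda>m. \<integral>\<^sup>+w. ennreal (cmod (\<sigma> (m, w) * stft g f (m, w))) \<partial>torus) < \<infinity>"
proof -
  obtain C :: real where "C > 0"
    "\<And>\<sigma> f. \<sigma> \<in> mixed_orlicz \<Phi>\<^sub>1 \<Phi>\<^sub>2 \<Longrightarrow> orlicz_norm \<Phi>\<^sub>1 f < \<infinity> \<Longrightarrow>
      luxemburg_norm \<Phi>\<^sub>1 (count_space UNIV) (\<lambda>m. \<integral>\<^sup>+w. ennreal (cmod (\<sigma> (m, w) * stft g f (m, w))) \<partial>torus)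
        \<le> ennreal C * (mixed_norm \<Phi>\<^sub>1 \<Phi>\<^sub>2 \<sigma> * orlicz_norm \<Phi>\<^sub>1 f)"
    using luxemburg_symbol_stft_le[OF orlicz_gauge g] by blast
  then have "luxemburg_norm \<Phi>\<^sub>1 (count_space UNIV) (\<lambda>m. \<integral>\<^sup>+w. ennreal (cmod (\<sigma> (m, w) * stft g f (m, w))) \<partial>torus)
        \<le> ennreal C * (mixed_norm \<Phi>\<^sub>1 \<Phi>\<^sub>2 \<sigma> * orlicz_norm \<Phi>\<^sub>1 f)" using \<sigma> f by blast
  also have "\<dots> < \<infinity>" using \<sigma> f unfolding mixed_orlicz_def by (simp add: ennreal_mult_less_top)
  finally show ?thesis .
qed

text \<open>The constant collects the inverse window energy, the convolution bound for
  \<open>g\<^sub>2\<close> and the symbol bound for \<open>g\<^sub>1\<close>, none of which involves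
  \<sigma> or \<open>f\<close>.\<close>

lemma localization_synthesis_bound:
  fixes g\<^sub>0 g\<^sub>1 g\<^sub>2 :: "int ^ 'n::finite \<Rightarrow> complex"
  assumes orlicz_gauge: "orlicz_gauge \<Phi>\<^sub>1" "orlicz_gauge \<Phi>\<^sub>2" and g: "g\<^sub>1 \<in> schwartz" "g\<^sub>2 \<in> schwartz"
    and g0: "window_energy g\<^sub>0 \<noteq> 0"
  obtains C :: real where "C > 0"
    "\<And>\<sigma> f. \<sigma> \<in> mixed_orlicz \<Phi>\<^sub>1 \<Phi>\<^sub>2 \<Longrightarrow> orlicz_norm \<Phi>\<^sub>1 f < \<infinity> \<Longrightarrow>
      orlicz_norm \<Phi>\<^sub>1 (localization_synthesis g\<^sub>0 g\<^sub>1 g\<^sub>2 \<sigma> f) \<le> ennreal C * (mixed_norm \<Phi>\<^sub>1 \<Phi>\<^sub>2 \<sigma> * orlicz_norm \<Phi>\<^sub>1 f)"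
proof -
  interpret G1: orlicz_gauge \<Phi>\<^sub>1 by fact
  let ?c = "inverse (window_energy g\<^sub>0)"
  obtain A :: real where A: "A > 0"
    "\<And>\<sigma> f. \<sigma> \<in> mixed_orlicz \<Phi>\<^sub>1 \<Phi>\<^sub>2 \<Longrightarrow> orlicz_norm \<Phi>\<^sub>1 f < \<infinity> \<Longrightarrow>
      luxemburg_norm \<Phi>\<^sub>1 (count_space UNIV) (\<lambda>m. \<integral>\<^sup>+w. ennreal (cmod (\<sigma> (m, w) * stft g\<^sub>1 f (m, w))) \<partial>torus)
        \<le> ennreal A * (mixed_norm \<Phi>\<^sub>1 \<Phi>\<^sub>2 \<sigma> * orlicz_norm \<Phi>\<^sub>1 f)"
    using luxemburg_symbol_stft_le[OF orlicz_gauge g(1)] by blast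
  obtain B :: real where B: "B > 0"
    "\<And>S. luxemburg_norm \<Phi>\<^sub>1 (count_space UNIV) (\<lambda>k. \<integral>\<^sup>+m. ennreal (cmod (g\<^sub>2 (k - m))) * S m \<partial>count_space UNIV)
      \<le> ennreal B * luxemburg_norm \<Phi>\<^sub>1 (count_space UNIV) S"
    using luxemburg_window_convolution[OF orlicz_gauge(1) g(2)] by blast
  show thesis
  proof (rule that[of "cmod ?c * B * A"])
    show "cmod ?c * B * A > 0" using A B g0 by simp
    fix \<sigma> :: "(int ^ 'n) \<times> (real ^ 'n) \<Rightarrow> complex" and f :: "int ^ 'n \<Rightarrow> complex"
    assume \<sigma>: "\<sigma> \<in> mixed_orlicz \<Phi>\<^sub>1 \<Phi>\<^sub>2" and f: "orlicz_norm \<Phi>\<^sub>1 f < \<infinity>"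
    let ?S = "\<lambda>m. \<integral>\<^sup>+w. ennreal (cmod (\<sigma> (m, w) * stft g\<^sub>1 f (m, w))) \<partial>torus"
    let ?h = "\<lambda>k. \<integral>m. g\<^sub>2 (k - m) * (\<integral>w. \<sigma> (m, w) * stft g\<^sub>1 f (m, w) * character w k \<partial>torus) \<partial>count_space UNIV"
    have "ennreal (cmod (?h k)) \<le> (\<integral>\<^sup>+m. ennreal (cmod (g\<^sub>2 (k - m))) * ?S m \<partial>count_space UNIV)" for k
    proof -
      have "ennreal (cmod (?h k))
        \<le> (\<integral>\<^sup>+m. ennreal (cmod (g\<^sub>2 (k - m) * (\<integral>w. \<sigma> (m, w) * stft g\<^sub>1 f (m, w) * character w k \<partial>torus))) \<partial>count_space UNIV)"
        by (rule norm_integral_le_nn_integral)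
      also have "\<dots> \<le> (\<integral>\<^sup>+m. ennreal (cmod (g\<^sub>2 (k - m))) * ?S m \<partial>count_space UNIV)"
      proof (rule nn_integral_mono)
        fix m
        have "ennreal (cmod (\<integral>w. \<sigma> (m, w) * stft g\<^sub>1 f (m, w) * character w k \<partial>torus)) \<le> ?S m"
          using norm_integral_le_nn_integral[of torus "\<lambda>w. \<sigma> (m, w) * stft g\<^sub>1 f (m, w) * character w k"] by (simp add: norm_mult)
        then show "ennreal (cmod (g\<^sub>2 (k - m) * (\<integral>w. \<sigma> (m, w) * stft g\<^sub>1 f (m, w) * character w k \<partial>torus)))
          \<le> ennreal (cmod (g\<^sub>2 (k - m))) * ?S m"
          unfolding norm_mult[of "g\<^sub>2 (k - m)"] by (subst ennreal_mult) (auto intro: mult_left_mono)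
      qed
      finally show ?thesis .
    qed
    then have h: "orlicz_norm \<Phi>\<^sub>1 ?h \<le> luxemburg_norm \<Phi>\<^sub>1 (count_space UNIV) (\<lambda>k. \<integral>\<^sup>+m. ennreal (cmod (g\<^sub>2 (k - m))) * ?S m \<partial>count_space UNIV)"
      by (intro G1.luxemburg_mono)
    have "orlicz_norm \<Phi>\<^sub>1 (localization_synthesis g\<^sub>0 g\<^sub>1 g\<^sub>2 \<sigma> f) \<le> ennreal (cmod ?c) * orlicz_norm \<Phi>\<^sub>1 ?h"
      unfolding localization_synthesis_def by (rule G1.orlicz_norm_cmult_le)
    also have "\<dots> \<le> ennreal (cmod ?c) * (ennreal B * luxemburg_norm \<Phi>\<^sub>1 (count_space UNIV) ?S)"
      by (intro mult_left_mono order_trans[OF h] B) simp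
    also have "\<dots> \<le> ennreal (cmod ?c) * (ennreal B * (ennreal A * (mixed_norm \<Phi>\<^sub>1 \<Phi>\<^sub>2 \<sigma> * orlicz_norm \<Phi>\<^sub>1 f)))"
      by (intro mult_left_mono A \<sigma> f) simp_all
    also have "\<dots> = ennreal (cmod ?c * B * A) * (mixed_norm \<Phi>\<^sub>1 \<Phi>\<^sub>2 \<sigma> * orlicz_norm \<Phi>\<^sub>1 f)"
      using A B by (simp add: ennreal_mult mult.assoc)
    finally show "orlicz_norm \<Phi>\<^sub>1 (localization_synthesis g\<^sub>0 g\<^sub>1 g\<^sub>2 \<sigma> f)
      \<le> ennreal (cmod ?c * B * A) * (mixed_norm \<Phi>\<^sub>1 \<Phi>\<^sub>2 \<sigma> * orlicz_norm \<Phi>\<^sub>1 f)" .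
  qed
qed

text \<open>Both sides become lattice sums against \<open>h\<close>, by \<open>stft_pairing\<close>
  and \<open>duality_pairing_eq\<close>, and the window energy cancels its inverse.\<close>

lemma duality_pairing_localization_synthesis:
  fixes g\<^sub>0 g\<^sub>1 g\<^sub>2 :: "int ^ 'n::finite \<Rightarrow> complex"
  assumes orlicz_gauge: "orlicz_gauge \<Phi>\<^sub>1" "orlicz_gauge (complementary \<Phi>\<^sub>1)" "orlicz_gauge \<Phi>\<^sub>2"
    and g: "g\<^sub>0 \<in> schwartz" "g\<^sub>0 \<noteq> (\<lambda>k. 0)" "g\<^sub>1 \<in> schwartz" "g\<^sub>2 \<in> schwartz"
    and \<sigma>: "\<sigma> \<in> mixed_orlicz \<Phi>\<^sub>1 \<Phi>\<^sub>2" and f: "orlicz_norm \<Phi>\<^sub>1 f < \<infinity>"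
    and T: "orlicz_norm \<Phi>\<^sub>1 (localization_synthesis g\<^sub>0 g\<^sub>1 g\<^sub>2 \<sigma> f) < \<infinity>"
    and h: "orlicz_norm (complementary \<Phi>\<^sub>1) h < \<infinity>"
  shows "duality_pairing g\<^sub>0 (localization_synthesis g\<^sub>0 g\<^sub>1 g\<^sub>2 \<sigma> f) h = localization_form g\<^sub>1 g\<^sub>2 \<sigma> f h"
proof -
  let ?F = "\<lambda>x. \<sigma> x * stft g\<^sub>1 f x"
  let ?h = "\<lambda>k. \<integral>m. g\<^sub>2 (k - m) * (\<integral>w. \<sigma> (m, w) * stft g\<^sub>1 f (m, w) * character w k \<partial>torus) \<partial>count_space UNIV"
  have meas: "?F \<in> borel_measurable (count_space UNIV \<Otimes>\<^sub>M torus)"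
    using \<sigma> stft_measurable[OF orlicz_gauge.orlicz_norm_finite_tempered[OF orlicz_gauge(1) f] g(3)]
    unfolding mixed_orlicz_def by (intro borel_measurable_times) auto
  have "localization_form g\<^sub>1 g\<^sub>2 \<sigma> f h = (\<integral>k. cnj (h k) * ?h k \<partial>count_space UNIV)"
    unfolding localization_form_def
    by (rule stft_pairing[OF orlicz_gauge(1,2) g(4) h meas luxemburg_symbol_stft_finite[OF orlicz_gauge(1,3) g(3) \<sigma> f]])
  moreover have "duality_pairing g\<^sub>0 (localization_synthesis g\<^sub>0 g\<^sub>1 g\<^sub>2 \<sigma> f) h
      = window_energy g\<^sub>0 * (\<integral>k. cnj (h k) * localization_synthesis g\<^sub>0 g\<^sub>1 g\<^sub>2 \<sigma> f k \<partial>count_space UNIV)"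
    by (rule duality_pairing_eq[OF orlicz_gauge g(1) T h])
  moreover have "(\<lambda>k. cnj (h k) * localization_synthesis g\<^sub>0 g\<^sub>1 g\<^sub>2 \<sigma> f k) = (\<lambda>k. inverse (window_energy g\<^sub>0) * (cnj (h k) * ?h k))"
    unfolding localization_synthesis_def by (simp add: mult_ac)
  ultimately show ?thesis using window_energy_nonzero[OF g(1,2)] by simp
qed

lemma stft_add:
  assumes "f \<in> tempered" "h \<in> tempered" "g \<in> schwartz"
  shows "stft g (\<lambda>k. f k + h k) (m, w) = stft g f (m, w) + stft g h (m, w)"
proof -
  note i = tempered_window_integrable[OF assms(1,3), of m] tempered_window_integrable[OF assms(2,3), of m]
  have i3: "integrable (count_space UNIV) (\<lambda>k. (f k + h k) * cnj (g (k - m)))"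
    using Bochner_Integration.integrable_add[OF i] by (simp add: distrib_right)
  have c: "integrable (count_space UNIV) (\<lambda>k. F k * cnj (character w k))" if "integrable (count_space UNIV) F" for F
    by (rule Bochner_Integration.integrable_bound[OF that]) (auto simp: norm_mult)
  show ?thesis
    unfolding stft_eq_integral[OF i(1)] stft_eq_integral[OF i(2)] stft_eq_integral[OF i3]
    by (subst Bochner_Integration.integral_add[OF c[OF i(1)] c[OF i(2)], symmetric]) (simp add: distrib_right)
qed

lemma stft_cmult:
  assumes "f \<in> tempered" "g \<in> schwartz"
  shows "stft g (\<lambda>k. c * f k) (m, w) = c * stft g f (m, w)"
proof -
  note i = tempered_window_integrable[OF assms, of m]
  have i2: "integrable (count_space UNIV) (\<lambda>k. c * f k * cnj (g (k - m)))"
    using integrable_mult_right[OF i, of c] by (simp add: mult.assoc)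
  show ?thesis
    unfolding stft_eq_integral[OF i] stft_eq_integral[OF i2]
    by (subst integral_mult_right_zero[symmetric]) (simp add: mult.assoc)
qed

text \<open>A scalar leaves a Bochner integral even when the integrand is not integrable, since both
  sides are then 0 by convention.\<close>

lemma localization_synthesis_cmult:
  assumes "f \<in> tempered" "g\<^sub>1 \<in> schwartz"
  shows "localization_synthesis g\<^sub>0 g\<^sub>1 g\<^sub>2 \<sigma> (\<lambda>k. c * f k) = (\<lambda>k. c * localization_synthesis g\<^sub>0 g\<^sub>1 g\<^sub>2 \<sigma> f k)"
proof
  fix k
  have "(\<integral>w. \<sigma> (m, w) * stft g\<^sub>1 (\<lambda>k. c * f k) (m, w) * character w k \<partial>torus)
      = c * (\<integral>w. \<sigma> (m, w) * stft g\<^sub>1 f (m, w) * character w k \<partial>torus)" for m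
    unfolding stft_cmult[OF assms] by (subst integral_mult_right_zero[symmetric]) (simp add: mult_ac)
  then have "(\<lambda>m. g\<^sub>2 (k - m) * (\<integral>w. \<sigma> (m, w) * stft g\<^sub>1 (\<lambda>k. c * f k) (m, w) * character w k \<partial>torus))
      = (\<lambda>m. c * (g\<^sub>2 (k - m) * (\<integral>w. \<sigma> (m, w) * stft g\<^sub>1 f (m, w) * character w k \<partial>torus)))"
    by (simp add: mult.left_commute)
  then show "localization_synthesis g\<^sub>0 g\<^sub>1 g\<^sub>2 \<sigma> (\<lambda>k. c * f k) k = c * localization_synthesis g\<^sub>0 g\<^sub>1 g\<^sub>2 \<sigma> f k"
    unfolding localization_synthesis_def by simp
qed

text \<open>Unlike scalars, sums may be split only where both integrals converge: over the torus
  because the symbol bound is finite at each \<open>m\<close>, over the lattice by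
  \<open>synthesis_integrable\<close>.\<close>

lemma localization_synthesis_add:
  fixes g\<^sub>0 g\<^sub>1 g\<^sub>2 :: "int ^ 'n::finite \<Rightarrow> complex"
  assumes orlicz_gauge: "orlicz_gauge \<Phi>\<^sub>1" "orlicz_gauge \<Phi>\<^sub>2" and g: "g\<^sub>1 \<in> schwartz" "g\<^sub>2 \<in> schwartz"
    and \<sigma>: "\<sigma> \<in> mixed_orlicz \<Phi>\<^sub>1 \<Phi>\<^sub>2" and f: "orlicz_norm \<Phi>\<^sub>1 f < \<infinity>" and h: "orlicz_norm \<Phi>\<^sub>1 h < \<infinity>"
  shows "localization_synthesis g\<^sub>0 g\<^sub>1 g\<^sub>2 \<sigma> (\<lambda>k. f k + h k)
    = (\<lambda>k. localization_synthesis g\<^sub>0 g\<^sub>1 g\<^sub>2 \<sigma> f k + localization_synthesis g\<^sub>0 g\<^sub>1 g\<^sub>2 \<sigma> h k)"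
proof
  fix k
  interpret G1: orlicz_gauge \<Phi>\<^sub>1 by fact
  obtain t :: real where t: "t > 0" "1 \<le> \<Phi>\<^sub>1 (ennreal t)" using G1.large by auto
  have [measurable]: "\<sigma> \<in> borel_measurable (count_space UNIV \<Otimes>\<^sub>M torus)" using \<sigma> unfolding mixed_orlicz_def by simp
  have int: "integrable torus (\<lambda>w. \<sigma> (m, w) * stft g\<^sub>1 u (m, w) * character w k)" if u: "orlicz_norm \<Phi>\<^sub>1 u < \<infinity>" for u m
  proof (rule integrableI_bounded)
    have [measurable]: "stft g\<^sub>1 u \<in> borel_measurable (count_space UNIV \<Otimes>\<^sub>M torus)"
      using stft_measurable[OF G1.orlicz_norm_finite_tempered[OF u] g(1)] .
    show "(\<lambda>w. \<sigma> (m, w) * stft g\<^sub>1 u (m, w) * character w k) \<in> borel_measurable torus" by measurable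
    have "(\<integral>\<^sup>+w. ennreal (cmod (\<sigma> (m, w) * stft g\<^sub>1 u (m, w))) \<partial>torus) < \<infinity>"
      using luxemburg_symbol_stft_finite[OF orlicz_gauge g(1) \<sigma> u]
      by (intro le_less_trans[OF G1.le_luxemburg[OF t, of "\<lambda>m. \<integral>\<^sup>+w. ennreal (cmod (\<sigma> (m, w) * stft g\<^sub>1 u (m, w))) \<partial>torus"]])
        (simp add: ennreal_mult_less_top)
    then show "(\<integral>\<^sup>+w. ennreal (norm (\<sigma> (m, w) * stft g\<^sub>1 u (m, w) * character w k)) \<partial>torus) < \<infinity>"
      by (simp add: norm_mult)
  qed
  note ft = G1.orlicz_norm_finite_tempered[OF f] G1.orlicz_norm_finite_tempered[OF h]
  let ?F = "\<lambda>u m. \<integral>w. \<sigma> (m, w) * stft g\<^sub>1 u (m, w) * character w k \<partial>torus"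
  have syn: "integrable (count_space UNIV) (\<lambda>m. g\<^sub>2 (k - m) * ?F u m)" if u: "orlicz_norm \<Phi>\<^sub>1 u < \<infinity>" for u
    by (rule synthesis_integrable[OF orlicz_gauge(1) g(2) luxemburg_symbol_stft_finite[OF orlicz_gauge g(1) \<sigma> u]])
  have "?F (\<lambda>k. f k + h k) m = ?F f m + ?F h m" for m
    unfolding stft_add[OF ft g(1)]
    by (subst Bochner_Integration.integral_add[OF int[OF f] int[OF h], symmetric]) (simp add: distrib_left distrib_right)
  then have "(\<integral>m. g\<^sub>2 (k - m) * ?F (\<lambda>k. f k + h k) m \<partial>count_space UNIV)
      = (\<integral>m. g\<^sub>2 (k - m) * ?F f m + g\<^sub>2 (k - m) * ?F h m \<partial>count_space UNIV)" by (simp add: distrib_left)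
  also have "\<dots> = (\<integral>m. g\<^sub>2 (k - m) * ?F f m \<partial>count_space UNIV) + (\<integral>m. g\<^sub>2 (k - m) * ?F h m \<partial>count_space UNIV)"
    by (rule Bochner_Integration.integral_add[OF syn[OF f] syn[OF h]])
  finally show "localization_synthesis g\<^sub>0 g\<^sub>1 g\<^sub>2 \<sigma> (\<lambda>k. f k + h k) k
    = localization_synthesis g\<^sub>0 g\<^sub>1 g\<^sub>2 \<sigma> f k + localization_synthesis g\<^sub>0 g\<^sub>1 g\<^sub>2 \<sigma> h k"
    unfolding localization_synthesis_def by (simp add: distrib_left)
qed

text \<open>The weak identity is part of the claim because a definite description says nothing by
  itself: it certifies that the value of \<open>THE\<close> represents the form. The constant
  precedes \<sigma>, which makes the estimate uniform in the symbol.\<close>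

theorem theorem4p14:
  fixes \<Phi>\<^sub>1 \<Phi>\<^sub>2 \<Psi>\<^sub>1 \<Psi>\<^sub>2 :: "ennreal \<Rightarrow> ennreal"
    and g\<^sub>0 g\<^sub>1 g\<^sub>2 :: "int ^ 'n::finite \<Rightarrow> complex"
    and x\<^sub>0 :: real
  assumes "complementary_young_pair \<Phi>\<^sub>1 \<Psi>\<^sub>1" and "complementary_young_pair \<Phi>\<^sub>2 \<Psi>\<^sub>2"
    and "local_Delta2 \<Phi>\<^sub>1" and "local_Delta2 \<Phi>\<^sub>2" and "local_Delta2 \<Psi>\<^sub>1" and "local_Delta2 \<Psi>\<^sub>2"
    and "strictly_convex \<Phi>\<^sub>1" and "strictly_convex \<Phi>\<^sub>2"
    and "strictly_convex \<Psi>\<^sub>1" and "strictly_convex \<Psi>\<^sub>2"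
    and "continuous_on UNIV \<Phi>\<^sub>1" and "continuous_on UNIV \<Phi>\<^sub>2"
    and "continuous_on UNIV \<Psi>\<^sub>1" and "continuous_on UNIV \<Psi>\<^sub>2"
    and "g\<^sub>0 \<in> schwartz" and "g\<^sub>0 \<noteq> (\<lambda>k. 0)"
    and "g\<^sub>1 \<in> schwartz" and "g\<^sub>2 \<in> schwartz"
    and "x\<^sub>0 > 0" and "dominated_near_0 x\<^sub>0 \<Psi>\<^sub>1 \<Phi>\<^sub>1" and "dominated_near_0 x\<^sub>0 \<Psi>\<^sub>2 \<Phi>\<^sub>2"
  shows "\<exists>C>0. \<forall>\<sigma>\<in>mixed_orlicz \<Phi>\<^sub>1 \<Phi>\<^sub>2.
    (let X = modulation_space g\<^sub>0 \<Phi>\<^sub>1 \<Phi>\<^sub>2; N = modulation_norm g\<^sub>0 \<Phi>\<^sub>1 \<Phi>\<^sub>2;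
         L = localization_operator g\<^sub>0 \<Phi>\<^sub>1 \<Phi>\<^sub>2 \<Psi>\<^sub>1 \<Psi>\<^sub>2 g\<^sub>1 g\<^sub>2 \<sigma>
     in (\<forall>f\<in>X. \<forall>h\<in>modulation_space g\<^sub>0 \<Psi>\<^sub>1 \<Psi>\<^sub>2.
            duality_pairing g\<^sub>0 (L f) h = localization_form g\<^sub>1 g\<^sub>2 \<sigma> f h) \<and>
        L \<in> bounded_operators X N \<and>
        operator_norm X N L \<le> ennreal C * mixed_norm \<Phi>\<^sub>1 \<Phi>\<^sub>2 \<sigma>)"
proof -
  have \<Psi>: "\<Psi>\<^sub>1 = complementary \<Phi>\<^sub>1" "\<Psi>\<^sub>2 = complementary \<Phi>\<^sub>2"
    using assms(1,2) unfolding complementary_young_pair_def by auto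
  have \<Phi>1: "orlicz_gauge \<Phi>\<^sub>1" and \<Phi>2: "orlicz_gauge \<Phi>\<^sub>2"
    using assms(1,2,11,12) unfolding complementary_young_pair_def by (auto intro: young_function_gauge)
  have \<Psi>1: "orlicz_gauge (complementary \<Phi>\<^sub>1)" and \<Psi>2: "orlicz_gauge (complementary \<Phi>\<^sub>2)"
    using assms(13,14) \<Phi>1 \<Phi>2 unfolding \<Psi> by (auto intro: complementary_gauge)
  interpret G1: orlicz_gauge \<Phi>\<^sub>1 by (rule \<Phi>1)
  note g0 = assms(15,16) and g1 = assms(17) and g2 = assms(18)
  let ?X = "modulation_space g\<^sub>0 \<Phi>\<^sub>1 \<Phi>\<^sub>2"
  let ?N = "modulation_norm g\<^sub>0 \<Phi>\<^sub>1 \<Phi>\<^sub>2"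
  have X: "?X = {f. orlicz_norm \<Phi>\<^sub>1 f < \<infinity>}" by (rule modulation_space_eq[OF \<Phi>1 \<Phi>2 g0])
  have Y: "modulation_space g\<^sub>0 \<Psi>\<^sub>1 \<Psi>\<^sub>2 = {f. orlicz_norm (complementary \<Phi>\<^sub>1) f < \<infinity>}"
    unfolding \<Psi> by (rule modulation_space_eq[OF \<Psi>1 \<Psi>2 g0])
  obtain A :: real where A: "A > 0"
    "\<And>f. orlicz_norm \<Phi>\<^sub>1 f < \<infinity> \<Longrightarrow> ?N f \<le> ennreal A * orlicz_norm \<Phi>\<^sub>1 f"
    using mixed_norm_stft_le[OF \<Phi>1 \<Phi>2 g0(1)] unfolding modulation_norm_def by blast
  obtain B :: real where B: "B > 0"
    "\<And>f. f \<in> tempered \<Longrightarrow> orlicz_norm \<Phi>\<^sub>1 f \<le> ennreal B * ?N f"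
    using orlicz_norm_le_mixed_norm_stft[OF \<Phi>1 \<Phi>2 g0] unfolding modulation_norm_def by blast
  obtain D :: real where D: "D > 0"
    "\<And>\<sigma> f. \<sigma> \<in> mixed_orlicz \<Phi>\<^sub>1 \<Phi>\<^sub>2 \<Longrightarrow> orlicz_norm \<Phi>\<^sub>1 f < \<infinity> \<Longrightarrow>
      orlicz_norm \<Phi>\<^sub>1 (localization_synthesis g\<^sub>0 g\<^sub>1 g\<^sub>2 \<sigma> f) \<le> ennreal D * (mixed_norm \<Phi>\<^sub>1 \<Phi>\<^sub>2 \<sigma> * orlicz_norm \<Phi>\<^sub>1 f)"
    using localization_synthesis_bound[OF \<Phi>1 \<Phi>2 g1 g2 window_energy_nonzero[OF g0]] by blast
  \<comment> \<open>\<open>B\<close> passes from the modulation norm to the Orlicz norm,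
    \<open>D\<close> bounds the synthesis there, and \<open>A\<close> passes back.\<close>
  let ?C = "A * D * B"
  show ?thesis
  proof (intro exI[of _ ?C] conjI ballI)
    show "?C > 0" using A B D by simp
    fix \<sigma> :: "(int ^ 'n) \<times> (real ^ 'n) \<Rightarrow> complex" assume \<sigma>: "\<sigma> \<in> mixed_orlicz \<Phi>\<^sub>1 \<Phi>\<^sub>2"
    let ?T = "localization_synthesis g\<^sub>0 g\<^sub>1 g\<^sub>2 \<sigma>"
    let ?L = "localization_operator g\<^sub>0 \<Phi>\<^sub>1 \<Phi>\<^sub>2 \<Psi>\<^sub>1 \<Psi>\<^sub>2 g\<^sub>1 g\<^sub>2 \<sigma>"
    have \<sigma>_fin: "mixed_norm \<Phi>\<^sub>1 \<Phi>\<^sub>2 \<sigma> < \<infinity>" using \<sigma> unfolding mixed_orlicz_def by simp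
    have T_fin: "orlicz_norm \<Phi>\<^sub>1 (?T f) < \<infinity>" if "orlicz_norm \<Phi>\<^sub>1 f < \<infinity>" for f
      using D(2)[OF \<sigma> that] by (rule le_less_trans) (use \<sigma>_fin that in \<open>simp add: ennreal_mult_less_top\<close>)
    have T_form: "duality_pairing g\<^sub>0 (?T f) h = localization_form g\<^sub>1 g\<^sub>2 \<sigma> f h"
      if "orlicz_norm \<Phi>\<^sub>1 f < \<infinity>" "orlicz_norm (complementary \<Phi>\<^sub>1) h < \<infinity>" for f h
      by (rule duality_pairing_localization_synthesis[OF \<Phi>1 \<Psi>1 \<Phi>2 g0 g1 g2 \<sigma> that(1) T_fin[OF that(1)] that(2)])
    \<comment> \<open>Existence by \<open>T_form\<close> and uniqueness by separation of points give
      the definite description its value; from here on linearity and bounds of \<open>?T\<close>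
      transfer to \<open>?L\<close>.\<close>
    have L_eq: "?L f = ?T f" if f: "orlicz_norm \<Phi>\<^sub>1 f < \<infinity>" for f
      unfolding localization_operator_def X Y
    proof (rule the_equality)
      show "?T f \<in> {f. orlicz_norm \<Phi>\<^sub>1 f < \<infinity>} \<and> (\<forall>h\<in>{f. orlicz_norm (complementary \<Phi>\<^sub>1) f < \<infinity>}.
          duality_pairing g\<^sub>0 (?T f) h = localization_form g\<^sub>1 g\<^sub>2 \<sigma> f h)"
        using T_fin T_form f by auto
      fix u assume u: "u \<in> {f. orlicz_norm \<Phi>\<^sub>1 f < \<infinity>} \<and> (\<forall>h\<in>{f. orlicz_norm (complementary \<Phi>\<^sub>1) f < \<infinity>}.
          duality_pairing g\<^sub>0 u h = localization_form g\<^sub>1 g\<^sub>2 \<sigma> f h)"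
      show "u = ?T f"
        using u T_form[OF f] T_fin[OF f] by (intro duality_pairing_inject[OF \<Phi>1 \<Psi>1 \<Phi>2 g0]) auto
    qed
    have bound: "?N (?L f) \<le> ennreal ?C * mixed_norm \<Phi>\<^sub>1 \<Phi>\<^sub>2 \<sigma> * ?N f" if "f \<in> ?X" for f
    proof -
      have f: "orlicz_norm \<Phi>\<^sub>1 f < \<infinity>" using that X by simp
      have "?N (?L f) \<le> ennreal A * orlicz_norm \<Phi>\<^sub>1 (?T f)" unfolding L_eq[OF f] by (rule A(2)[OF T_fin[OF f]])
      also have "\<dots> \<le> ennreal A * (ennreal D * (mixed_norm \<Phi>\<^sub>1 \<Phi>\<^sub>2 \<sigma> * orlicz_norm \<Phi>\<^sub>1 f))"
        by (intro mult_left_mono D(2) \<sigma> f) simp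
      also have "\<dots> \<le> ennreal A * (ennreal D * (mixed_norm \<Phi>\<^sub>1 \<Phi>\<^sub>2 \<sigma> * (ennreal B * ?N f)))"
        by (intro mult_left_mono B(2) G1.orlicz_norm_finite_tempered f) simp_all
      also have "\<dots> = ennreal ?C * mixed_norm \<Phi>\<^sub>1 \<Phi>\<^sub>2 \<sigma> * ?N f"
        using A B D by (simp add: ennreal_mult ac_simps)
      finally show ?thesis .
    qed
    have "?L \<in> bounded_operators ?X ?N"
      unfolding bounded_operators_def
    proof (intro CollectI conjI ballI allI)
      fix f assume "f \<in> ?X"
      then have f: "orlicz_norm \<Phi>\<^sub>1 f < \<infinity>" using X by simp
      show "?L f \<in> ?X" using T_fin[OF f] unfolding X L_eq[OF f] by simp
      fix c :: complex
      have cf: "orlicz_norm \<Phi>\<^sub>1 (\<lambda>k. c * f k) < \<infinity>"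
        using G1.orlicz_norm_cmult_le by (rule le_less_trans) (use f in \<open>simp add: ennreal_mult_less_top\<close>)
      show "?L (\<lambda>k. c * f k) = (\<lambda>k. c * ?L f k)"
        unfolding L_eq[OF cf] L_eq[OF f] by (rule localization_synthesis_cmult[OF G1.orlicz_norm_finite_tempered[OF f] g1])
    next
      fix f h assume "f \<in> ?X" "h \<in> ?X"
      then have f: "orlicz_norm \<Phi>\<^sub>1 f < \<infinity>" and h: "orlicz_norm \<Phi>\<^sub>1 h < \<infinity>" using X by auto
      \<comment> \<open>The triangle inequality up to the factor 4 suffices, since only membership
        is at stake.\<close>
      have fh: "orlicz_norm \<Phi>\<^sub>1 (\<lambda>k. f k + h k) < \<infinity>"
        using G1.orlicz_norm_add_le by (rule le_less_trans) (use f h in \<open>simp add: ennreal_mult_less_top\<close>)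
      show "?L (\<lambda>k. f k + h k) = (\<lambda>k. ?L f k + ?L h k)"
        unfolding L_eq[OF fh] L_eq[OF f] L_eq[OF h] by (rule localization_synthesis_add[OF \<Phi>1 \<Phi>2 g1 g2 \<sigma> f h])
    next
      \<comment> \<open>\<open>bounded_operators\<close> asks for a real \<open>K\<close>; the
        finite norm of \<sigma> is absorbed into it.\<close>
      obtain s where s: "mixed_norm \<Phi>\<^sub>1 \<Phi>\<^sub>2 \<sigma> = ennreal s" "s \<ge> 0"
        using \<sigma>_fin by (cases "mixed_norm \<Phi>\<^sub>1 \<Phi>\<^sub>2 \<sigma>") auto
      have "ennreal ?C * mixed_norm \<Phi>\<^sub>1 \<Phi>\<^sub>2 \<sigma> = ennreal (?C * s)"
        using s A B D by (simp add: ennreal_mult)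
      then show "\<exists>K::real. \<forall>f\<in>?X. ?N (?L f) \<le> ennreal K * ?N f" using bound by (intro exI[of _ "?C * s"]) simp
    qed
    moreover have "operator_norm ?X ?N ?L \<le> ennreal ?C * mixed_norm \<Phi>\<^sub>1 \<Phi>\<^sub>2 \<sigma>"
      unfolding operator_norm_def
    proof (rule SUP_least, safe)
      fix f assume f: "f \<in> ?X" "?N f \<le> 1"
      have "?N (?L f) \<le> ennreal ?C * mixed_norm \<Phi>\<^sub>1 \<Phi>\<^sub>2 \<sigma> * ?N f" by (rule bound[OF f(1)])
      also have "\<dots> \<le> ennreal ?C * mixed_norm \<Phi>\<^sub>1 \<Phi>\<^sub>2 \<sigma> * 1" by (intro mult_left_mono f) simp
      finally show "?N (?L f) \<le> ennreal ?C * mixed_norm \<Phi>\<^sub>1 \<Phi>\<^sub>2 \<sigma>" by simp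
    qed
    moreover have "\<forall>f\<in>?X. \<forall>h\<in>modulation_space g\<^sub>0 \<Psi>\<^sub>1 \<Psi>\<^sub>2. duality_pairing g\<^sub>0 (?L f) h = localization_form g\<^sub>1 g\<^sub>2 \<sigma> f h"
      unfolding X Y using T_form L_eq by simp
    ultimately show "let X = ?X; N = ?N; L = ?L
     in (\<forall>f\<in>X. \<forall>h\<in>modulation_space g\<^sub>0 \<Psi>\<^sub>1 \<Psi>\<^sub>2.
            duality_pairing g\<^sub>0 (L f) h = localization_form g\<^sub>1 g\<^sub>2 \<sigma> f h) \<and>
        L \<in> bounded_operators X N \<and>
        operator_norm X N L \<le> ennreal ?C * mixed_norm \<Phi>\<^sub>1 \<Phi>\<^sub>2 \<sigma>"
      unfolding Let_def by blast
  qed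
qed

end
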